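(* Let $1 \le p \le 2$. There exist a constant $C_p>0$ (depending only on $p$) and thresholds $m_0,n_0\in\mathbb{N}$ such that for all $m,n\in\mathbb{N}$ with $m\ge m_0$ and $n \ge n_0$, $$e^{\mathrm{ran}}(n,\ \ell_p^m \hookrightarrow \ell_\infty^m)\ \le\ C_p\,\min\left\{1,\ \left(\frac{\log n+\log\log m}{n}\right)^{1/p}\right\}.$$
   Context: $\ell_p^m$ is $\mathbb{R}^m$ with norm $\|\boldsymbol{x}\|_p=(\sum_{i=1}^m|x_i|^p)^{1/p}$ for $1 \le p<\infty$, and $\ell_\infty^m$ is $\mathbb{R}^m$ with $\|\boldsymbol{x}\|_\infty=\max_i|x_i|$. $\ell_p^m\hookrightarrow\ell_\infty^m$ denotes the identity map $S(\boldsymbol{x})=\boldsymbol{x}$ regarded as an operator from $\ell_p^m$ to $\ell_\infty^m$. Let $S\colon F\to G$ be a linear operator between Banach spaces. A randomized (possibly adaptive) algorithm $A_n$ using at most $n$ linear measurements is given by a probability space $(\Omega,\Sigma,\mathbb{P})$ and, for each $\omega\in\Omega$, a rule that on input $f\in F$ computes successively $y_i=L_i(f)$, $i=1,\ldots,n$, where $L_i=L_i^{\omega}(\,\cdot\,;y_1,\ldots,y_{i-1})\in F'$ is a continuous linear functional that may depend on $\omega$ and on the previously obtained values $y_1,\ldots,y_{i-1}$, and then returns $A_n(\omega,f)=\phi^{\omega}(y_1,\ldots,y_n)\in G$. (The usual measurability in $(\omega,f)$ is assumed.) One writes $A_n(f)=A_n(\cdot,f)$ for the resulting $G$-valued random variable.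 The Monte Carlo error is $$e(A_n,S):=\sup_{\|f\|_F\le 1}\mathbb{E}\,\|A_n(f)-S(f)\|_G,$$ and $e^{\mathrm{ran}}(n,S):=\inf_{A_n}e(A_n,S)$, the infimum being over all (possibly adaptive) randomized algorithms using at most $n$ linear measurements. $\log$ is the natural logarithm. *)

theory Defs
  imports "HOL-Probability.Probability"
begin

(* R^m consists of the extensional functions {..<m} ->E UNIV, the space of this measurable space.
   Its product sigma-algebra is the Borel sigma-algebra of any norm on R^m. *)
abbreviation rvec :: "nat \<Rightarrow> (nat \<Rightarrow> real) measure" where
  "rvec m \<equiv> (\<Pi>\<^sub>M i\<in>{..<m}. (borel :: real measure))"

definition lp_norm :: "real \<Rightarrow> nat \<Rightarrow> (nat \<Rightarrow> real) \<Rightarrow> real" where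
  "lp_norm p m x = (\<Sum>i<m. \<bar>x i\<bar> powr p) powr (1 / p)"

(* For m = 0 the maximum ranges over the empty set and is unspecified. *)
definition linf_norm :: "nat \<Rightarrow> (nat \<Rightarrow> real) \<Rightarrow> real" where
  "linf_norm m x = Max ((\<lambda>i. \<bar>x i\<bar>) ` {..<m})"

(* Continuous linear functionals on R^m with norm N; as in bounded_linear, continuity is
   expressed by boundedness. *)
definition dual :: "nat \<Rightarrow> ((nat \<Rightarrow> real) \<Rightarrow> real) \<Rightarrow> ((nat \<Rightarrow> real) \<Rightarrow> real) set" where
  "dual m N = {l.
     (\<forall>x\<in>space (rvec m). \<forall>y\<in>space (rvec m). l (\<lambda>i\<in>{..<m}. x i + y i) = l x + l y) \<and>
     (\<forall>c. \<forall>x\<in>space (rvec m). l (\<lambda>i\<in>{..<m}. c * x i) = c * l x) \<and>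
     (\<exists>K. \<forall>x\<in>space (rvec m). \<bar>l x\<bar> \<le> K * N x)}"

(* The list [y_1, ..., y_k] of measured values. The functional used next is L applied to the
   list of the values obtained so far, whose length also tells which step is being performed. *)
primrec info :: "(real list \<Rightarrow> 'f \<Rightarrow> real) \<Rightarrow> 'f \<Rightarrow> nat \<Rightarrow> real list" where
  "info L f 0 = []"
| "info L f (Suc k) = info L f k @ [L (info L f k) f]"

definition alg_output ::
  "nat \<Rightarrow> ('w \<Rightarrow> real list \<Rightarrow> 'f \<Rightarrow> real) \<Rightarrow> ('w \<Rightarrow> real list \<Rightarrow> 'g) \<Rightarrow> 'w \<Rightarrow> 'f \<Rightarrow> 'g" where
  "alg_output k L \<phi> \<omega> f = \<phi> \<omega> (info (L \<omega>) f k)"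

(* Adaptive randomized algorithms using k measurements, for operators from R^m with norm NF
   to R^d. *)
definition randomized_algorithm ::
  "nat \<Rightarrow> nat \<Rightarrow> ((nat \<Rightarrow> real) \<Rightarrow> real) \<Rightarrow> nat \<Rightarrow> 'w measure \<Rightarrow>
   ('w \<Rightarrow> real list \<Rightarrow> (nat \<Rightarrow> real) \<Rightarrow> real) \<Rightarrow> ('w \<Rightarrow> real list \<Rightarrow> (nat \<Rightarrow> real)) \<Rightarrow> bool" where
  "randomized_algorithm k m NF d M L \<phi> \<longleftrightarrow>
     prob_space M \<and>
     (\<forall>\<omega>\<in>space M. \<forall>ys. length ys < k \<longrightarrow> L \<omega> ys \<in> dual m NF) \<and>
     (\<forall>\<omega>\<in>space M. \<forall>ys. length ys = k \<longrightarrow> \<phi> \<omega> ys \<in> space (rvec d)) \<and>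
     (\<lambda>(\<omega>, f). alg_output k L \<phi> \<omega> f) \<in> M \<Otimes>\<^sub>M rvec m \<rightarrow>\<^sub>M rvec d"

definition mc_error ::
  "nat \<Rightarrow> ((nat \<Rightarrow> real) \<Rightarrow> real) \<Rightarrow> nat \<Rightarrow> ((nat \<Rightarrow> real) \<Rightarrow> real) \<Rightarrow>
   ((nat \<Rightarrow> real) \<Rightarrow> (nat \<Rightarrow> real)) \<Rightarrow> 'w measure \<Rightarrow>
   ('w \<Rightarrow> (nat \<Rightarrow> real) \<Rightarrow> (nat \<Rightarrow> real)) \<Rightarrow> ennreal" where
  "mc_error m NF d NG S M A =
     (SUP f\<in>{f \<in> space (rvec m). NF f \<le> 1}.
        \<integral>\<^sup>+ \<omega>. ennreal (NG (\<lambda>i\<in>{..<d}. A \<omega> f i - S f i)) \<partial>M)"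

(* The n-th minimal Monte Carlo error of S from (R^m, NF) to (R^d, NG).
   Since HOL cannot quantify over types, the sample spaces are the probability spaces on subsets
   of nat => real, with arbitrary sigma-algebra. *)
definition e_ran ::
  "nat \<Rightarrow> nat \<Rightarrow> ((nat \<Rightarrow> real) \<Rightarrow> real) \<Rightarrow> nat \<Rightarrow> ((nat \<Rightarrow> real) \<Rightarrow> real) \<Rightarrow>
   ((nat \<Rightarrow> real) \<Rightarrow> (nat \<Rightarrow> real)) \<Rightarrow> ennreal" where
  "e_ran n m NF d NG S =
     Inf {mc_error m NF d NG S M (alg_output k L \<phi>) |
            k (M :: (nat \<Rightarrow> real) measure) L \<phi>.
            k \<le> n \<and> randomized_algorithm k m NF d M L \<phi>}"

end

theory Submission
  imports Defs
begin

text \<open>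
  Put \<open>h = k powr (- 1 / p)\<close> with \<open>k\<close> of order \<open>n / (ln n + ln (ln m))\<close>; a vector of the unit ball has at
  most \<open>k\<close> coordinates of size at least \<open>h\<close>, so it suffices to find all coordinates of size at least
  \<open>4 * h\<close> with probability \<open>1 - O(1 / n)\<close> and to measure them directly. All other coordinates are set
  to \<open>0\<close>, so that the error never exceeds \<open>1\<close>, even when the search fails.

  Every coordinate \<open>l\<close> receives a random label \<open>U l\<close>, which is read digit by digit, the radices growing
  doubly exponentially. The lowest digit, of polynomial size in \<open>n\<close>, assigns \<open>l\<close> to a bucket; with high
  probability a large coordinate dominates its bucket. The \<open>O(k)\<close> buckets of non-negligible energy are found from
  \<open>O(k * ln n)\<close> nonadaptive measurements: the buckets are hashed \<open>O(ln n)\<close> times into \<open>32 * k\<close> cells with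
  random signs, and a majority vote is taken. In each of these buckets the further digits of the label
  of the dominating coordinate are found adaptively, as the ratio of a digit-weighted and an
  unweighted signed sum over all coordinates sharing the digits known so far. Each digit known reduces
  the expected noise, which permits a larger radix for the next one, so \<open>O(ln (ln m))\<close> digits identify
  the coordinate.
\<close>

section \<open>Decision trees with linear queries\<close>

definition lin :: "nat \<Rightarrow> (nat \<Rightarrow> real) \<Rightarrow> (nat \<Rightarrow> real) \<Rightarrow> real" where
  "lin m c x = (\<Sum>i<m. c i * x i)"

text \<open>
  Adaptive algorithms are written as decision trees. The answers are rounded to multiples of \<open>\<eta>\<close>, so
  that the trees branch countably and every tree computes a measurable function.
\<close>

datatype 'o prog = Return 'o | Query "nat \<Rightarrow> real" "int \<Rightarrow> 'o prog"

primrec run :: "nat \<Rightarrow> real \<Rightarrow> (nat \<Rightarrow> real) \<Rightarrow> 'o prog \<Rightarrow> 'o" where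
  "run m \<eta> x (Return v) = v"
| "run m \<eta> x (Query c K) = run m \<eta> x (K \<lfloor>lin m c x / \<eta>\<rfloor>)"

inductive cost_le :: "nat \<Rightarrow> 'o prog \<Rightarrow> bool" where
  Return: "cost_le n (Return v)"
| Query: "(\<And>z. cost_le n (K z)) \<Longrightarrow> cost_le (Suc n) (Query c K)"

primrec bind_prog :: "'a prog \<Rightarrow> ('a \<Rightarrow> 'b prog) \<Rightarrow> 'b prog" where
  "bind_prog (Return v) F = F v"
| "bind_prog (Query c K) F = Query c (\<lambda>z. bind_prog (K z) F)"

primrec mapM :: "('a \<Rightarrow> 'b prog) \<Rightarrow> 'a list \<Rightarrow> 'b list prog" where
  "mapM F [] = Return []"
| "mapM F (a # as) = bind_prog (F a) (\<lambda>b. bind_prog (mapM F as) (\<lambda>bs. Return (b # bs)))"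

lemma run_bind [simp]: "run m \<eta> x (bind_prog t F) = run m \<eta> x (F (run m \<eta> x t))"
  by (induction t) auto

lemma run_mapM [simp]: "run m \<eta> x (mapM F as) = map (\<lambda>a. run m \<eta> x (F a)) as"
  by (induction as) auto

lemma cost_le_mono: "cost_le a t \<Longrightarrow> a \<le> b \<Longrightarrow> cost_le b t"
proof (induction arbitrary: b rule: cost_le.induct)
  case (Query n K c)
  then obtain b' where "b = Suc b'" "n \<le> b'" by (cases b) auto
  with Query show ?case by (auto intro: cost_le.Query)
qed (rule cost_le.Return)

lemma cost_le_bind:
  assumes "cost_le a t" "\<And>v. cost_le b (F v)"
  shows "cost_le (a + b) (bind_prog t F)"
  using assms(1)
proof induction
  case (Return n v)
  then show ?case using cost_le_mono[OF assms(2), of "n + b"] by simp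
next
  case (Query n K c)
  then show ?case by (auto intro: cost_le.Query)
qed

lemma cost_le_mapM:
  assumes "\<And>a. cost_le b (F a)"
  shows "cost_le (length as * b) (mapM F as)"
proof (induction as)
  case (Cons a as)
  have "cost_le (b + (length as * b + 0)) (mapM F (a # as))"
    unfolding mapM.simps
    by (intro cost_le_bind assms Cons.IH) (rule cost_le.Return)
  then show ?case by simp
qed (auto intro: cost_le.Return)

lemma measurable_lin [measurable]: "lin m c \<in> rvec m \<rightarrow>\<^sub>M borel"
proof -
  have "lin m c = (\<lambda>x. \<Sum>i<m. c i * x i)" by (auto simp: lin_def)
  also have "\<dots> \<in> rvec m \<rightarrow>\<^sub>M borel" by measurable
  finally show ?thesis .
qed

lemma measurable_run: "(\<lambda>x. run m \<eta> x t) \<in> rvec m \<rightarrow>\<^sub>M count_space UNIV"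
proof (induction t)
  case (Query c K)
  have "(\<lambda>x. run m \<eta> x (K \<lfloor>lin m c x / \<eta>\<rfloor>)) \<in> rvec m \<rightarrow>\<^sub>M count_space UNIV"
    by (rule measurable_compose_countable[where g = "\<lambda>x. \<lfloor>lin m c x / \<eta>\<rfloor>"])
       (use Query in auto)
  then show ?case by simp
qed auto

section \<open>Decision trees as adaptive algorithms\<close>

text \<open>The algorithm model supplies unrounded answers; \<open>walk\<close> performs the
  rounding of \<open>run\<close> and stays at a leaf once one is reached.\<close>

primrec walk :: "real \<Rightarrow> 'o prog \<Rightarrow> real list \<Rightarrow> 'o prog" where
  "walk \<eta> t [] = t"
| "walk \<eta> t (y # ys) = (case t of Return v \<Rightarrow> Return v | Query c K \<Rightarrow> walk \<eta> (K \<lfloor>y / \<eta>\<rfloor>) ys)"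

text \<open>A finished tree keeps asking the zero functional, so that every branch makes the same
  number of measurements.\<close>

definition prog_info :: "nat \<Rightarrow> real \<Rightarrow> 'o prog \<Rightarrow> real list \<Rightarrow> (nat \<Rightarrow> real) \<Rightarrow> real" where
  "prog_info m \<eta> t ys x = (case walk \<eta> t ys of Return v \<Rightarrow> 0 | Query c K \<Rightarrow> lin m c x)"

definition prog_result :: "nat \<Rightarrow> real \<Rightarrow> (nat \<Rightarrow> real) prog \<Rightarrow> real list \<Rightarrow> (nat \<Rightarrow> real)" where
  "prog_result m \<eta> t ys = restrict (case walk \<eta> t ys of Return v \<Rightarrow> v | Query c K \<Rightarrow> (\<lambda>_. 0)) {..<m}"

lemma walk_Return [simp]: "walk \<eta> (Return v) ys = Return v"
  by (induction ys) auto

text \<open>\<open>info\<close> appends the latest answer, whereas a tree is consumed from its root;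
  splitting off the first answer permits induction over the tree.\<close>

lemma info_Suc_left:
  "info L x (Suc k) = L [] x # info (\<lambda>ys. L (L [] x # ys)) x k"
  by (induction k) auto

lemma prog_info_Cons:
  "prog_info m \<eta> (Query c K) (y # ys) = prog_info m \<eta> (K \<lfloor>y / \<eta>\<rfloor>) ys"
  by (auto simp: prog_info_def)

lemma walk_info:
  "cost_le n t \<Longrightarrow> walk \<eta> t (info (prog_info m \<eta> t) x n) = Return (run m \<eta> x t)"
proof (induction rule: cost_le.induct)
  case (Query n K c)
  have *: "prog_info m \<eta> (Query c K) [] x = lin m c x" by (simp add: prog_info_def)
  show ?case
    unfolding info_Suc_left * using Query.IH by (simp add: prog_info_Cons)
qed auto

lemma abs_le_lp_norm:
  assumes "p > 0" "i < m"
  shows "\<bar>x i\<bar> \<le> lp_norm p m x"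
proof -
  have "\<bar>x i\<bar> powr p \<le> (\<Sum>i<m. \<bar>x i\<bar> powr p)"
    by (rule member_le_sum) (use assms in auto)
  then have "(\<bar>x i\<bar> powr p) powr (1/p) \<le> lp_norm p m x"
    unfolding lp_norm_def using assms by (intro powr_mono2) auto
  then show ?thesis using assms by (simp add: powr_powr)
qed

lemma lin_in_dual: "p > 0 \<Longrightarrow> lin m c \<in> dual m (lp_norm p m)"
proof -
  assume p: "p > 0"
  have "\<bar>lin m c x\<bar> \<le> (\<Sum>i<m. \<bar>c i\<bar>) * lp_norm p m x" for x
  proof -
    have "\<bar>lin m c x\<bar> \<le> (\<Sum>i<m. \<bar>c i * x i\<bar>)" unfolding lin_def by (rule sum_abs)
    also have "\<dots> \<le> (\<Sum>i<m. \<bar>c i\<bar> * lp_norm p m x)"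
      using abs_le_lp_norm[OF p] by (intro sum_mono) (auto simp: abs_mult intro!: mult_left_mono)
    finally show ?thesis by (simp add: sum_distrib_right)
  qed
  then have "\<exists>K. \<forall>x\<in>space (rvec m). \<bar>lin m c x\<bar> \<le> K * lp_norm p m x" by blast
  then show ?thesis
    by (auto simp: dual_def lin_def sum.distrib algebra_simps sum_distrib_left)
qed

text \<open>Settles measurability, continuity and the sample space once and for all; only the cost
  and the expected error of a finitely supported random tree remain to be estimated.\<close>

lemma e_ran_le:
  fixes Q :: "'w pmf" and t :: "'w \<Rightarrow> (nat \<Rightarrow> real) prog"
  assumes p: "p > 0" and fin: "finite (set_pmf Q)"
    and cost: "\<And>w. w \<in> set_pmf Q \<Longrightarrow> cost_le n (t w)"
    and err: "\<And>x. x \<in> space (rvec m) \<Longrightarrow> lp_norm p m x \<le> 1 \<Longrightarrow>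
        (\<integral>\<^sup>+w. ennreal (linf_norm m (\<lambda>i. run m \<eta> x (t w) i - x i)) \<partial>Q) \<le> c"
  shows "e_ran n m (lp_norm p m) m (linf_norm m) (\<lambda>x. x) \<le> c"
proof -
  \<comment> \<open>\<open>e_ran\<close> admits sample spaces on
    \<open>nat \<Rightarrow> real\<close> only; the finitely many seeds are numbered and encoded as
    constant sequences.\<close>
  obtain e :: "'w \<Rightarrow> nat \<Rightarrow> real" where e: "inj_on e (set_pmf Q)"
  proof
    show "inj_on (\<lambda>w (i::nat). real (to_nat_on (set_pmf Q) w)) (set_pmf Q)"
      using fin by (intro inj_onI) (auto simp: fun_eq_iff dest: inj_onD[OF inj_on_to_nat_on[OF countable_finite]])
  qed
  define d where "d = the_inv_into (set_pmf Q) e"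
  have d: "d (e w) = w" if "w \<in> set_pmf Q" for w
    using that e by (simp add: d_def the_inv_into_f_f)
  define N where "N = map_pmf e Q"
  \<comment> \<open>On the countable support all subsets are measurable, so joint measurability
    reduces to measurability for each fixed seed.\<close>
  define M where "M = restrict_space (measure_pmf N) (set_pmf N)"
  have spM: "space M = e ` set_pmf Q" by (simp add: M_def N_def space_restrict_space)
  have setsM: "sets M = sets (count_space (set_pmf N))"
    by (auto simp: M_def sets_restrict_space)
  define L where "L = (\<lambda>\<omega>. prog_info m \<eta> (t (d \<omega>)))"
  define \<phi> where "\<phi> = (\<lambda>\<omega>. prog_result m \<eta> (t (d \<omega>)))"
  have out: "alg_output n L \<phi> (e w) x = restrict (run m \<eta> x (t w)) {..<m}" if "w \<in> set_pmf Q" for w x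
    using that cost by (simp add: alg_output_def L_def \<phi>_def d prog_result_def walk_info)
  have meas: "(\<lambda>(\<omega>, f). alg_output n L \<phi> \<omega> f) \<in> count_space (set_pmf N) \<Otimes>\<^sub>M rvec m \<rightarrow>\<^sub>M rvec m"
  proof (rule measurable_pair_measure_countable1)
    fix \<omega> assume "\<omega> \<in> set_pmf N"
    then obtain w where w: "w \<in> set_pmf Q" "\<omega> = e w" by (auto simp: N_def)
    have "(\<lambda>v. restrict v {..<m}) \<in> count_space UNIV \<rightarrow>\<^sub>M rvec m"
      by (auto simp: space_PiM)
    from measurable_compose[OF measurable_run this]
    show "(\<lambda>f. case (\<omega>, f) of (\<omega>, f) \<Rightarrow> alg_output n L \<phi> \<omega> f) \<in> rvec m \<rightarrow>\<^sub>M rvec m"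
      using w by (simp add: out)
  qed simp
  have "emeasure (measure_pmf N) (set_pmf N) = 1"
    by (simp add: emeasure_pmf)
  then have "prob_space M"
    unfolding M_def by (intro prob_space_restrict_space) auto
  moreover have "L \<omega> ys \<in> dual m (lp_norm p m)" for \<omega> ys
  proof -
    have "(\<lambda>x. 0) = lin m (\<lambda>_. 0)" by (auto simp: lin_def)
    then show ?thesis unfolding L_def prog_info_def
      by (cases "walk \<eta> (t (d \<omega>)) ys") (auto simp: lin_in_dual[OF p])
  qed
  ultimately have alg: "randomized_algorithm n m (lp_norm p m) m M L \<phi>"
    using meas
    by (auto simp: randomized_algorithm_def \<phi>_def prog_result_def space_PiM
        measurable_cong_sets[OF sets_pair_measure_cong[OF setsM refl] refl])
  have "mc_error m (lp_norm p m) m (linf_norm m) (\<lambda>x. x) M (alg_output n L \<phi>) \<le> c"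
    unfolding mc_error_def
  proof (rule SUP_least)
    fix x assume x: "x \<in> {f \<in> space (rvec m). lp_norm p m f \<le> 1}"
    have linf: "linf_norm m (\<lambda>i\<in>{..<m}. u i) = linf_norm m u" for u
      by (auto simp: linf_norm_def intro!: arg_cong[where f = Max] image_cong)
    have "(\<integral>\<^sup>+ \<omega>. ennreal (linf_norm m (\<lambda>i\<in>{..<m}. alg_output n L \<phi> \<omega> x i - x i)) \<partial>M)
        = (\<integral>\<^sup>+ \<omega>. ennreal (linf_norm m (\<lambda>i\<in>{..<m}. alg_output n L \<phi> \<omega> x i - x i)) \<partial>N)"
      unfolding M_def
      by (subst nn_integral_restrict_space)
         (auto intro!: nn_integral_cong_AE simp: AE_measure_pmf_iff)
    also have "\<dots> = (\<integral>\<^sup>+w. ennreal (linf_norm m (\<lambda>i. run m \<eta> x (t w) i - x i)) \<partial>Q)"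
      unfolding N_def nn_integral_map_pmf linf
      by (intro nn_integral_cong_AE)
         (auto simp: AE_measure_pmf_iff out linf_norm_def intro!: arg_cong[where f = Max] image_cong)
    also have "\<dots> \<le> c" using x by (intro err) auto
    finally show "(\<integral>\<^sup>+ \<omega>. ennreal (linf_norm m (\<lambda>i\<in>{..<m}. alg_output n L \<phi> \<omega> x i - x i)) \<partial>M) \<le> c" .
  qed
  moreover have "e_ran n m (lp_norm p m) m (linf_norm m) (\<lambda>x. x)
      \<le> mc_error m (lp_norm p m) m (linf_norm m) (\<lambda>x. x) M (alg_output n L \<phi>)"
    unfolding e_ran_def using alg by (intro Inf_lower) blast
  ultimately show ?thesis by simp
qed

section \<open>Random signs and hash functions\<close>

lemma expectation_pair_pmf_finite:
  fixes f :: "_ \<Rightarrow> real"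
  assumes "finite (set_pmf A)" "finite (set_pmf B)"
  shows "measure_pmf.expectation (pair_pmf A B) f =
         measure_pmf.expectation A (\<lambda>a. measure_pmf.expectation B (\<lambda>b. f (a, b)))"
proof -
  have "pair_pmf A B = A \<bind> (\<lambda>a. map_pmf (Pair a) B)"
    by (simp add: pair_pmf_def map_pmf_def)
  moreover have "measure_pmf.expectation (A \<bind> (\<lambda>a. map_pmf (Pair a) B)) f =
      (\<Sum>a\<in>set_pmf A. pmf A a *\<^sub>R measure_pmf.expectation (map_pmf (Pair a) B) f)"
    by (rule pmf_expectation_bind) (use assms in auto)
  moreover have "measure_pmf.expectation A (\<lambda>a. measure_pmf.expectation B (\<lambda>b. f (a, b))) =
      (\<Sum>a\<in>set_pmf A. pmf A a *\<^sub>R measure_pmf.expectation B (\<lambda>b. f (a, b)))"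
    by (rule integral_measure_pmf) (use assms in auto)
  ultimately show ?thesis by simp
qed

lemma prob_pair_pmf:
  assumes "finite (set_pmf A)" "finite (set_pmf B)"
  shows "measure_pmf.prob (pair_pmf A B) X =
         measure_pmf.expectation A (\<lambda>a. measure_pmf.prob B {b. (a, b) \<in> X})"
proof -
  have "measure_pmf.prob (pair_pmf A B) X = measure_pmf.expectation (pair_pmf A B) (indicator X)"
    by simp
  also have "\<dots> = measure_pmf.expectation A (\<lambda>a. measure_pmf.expectation B (\<lambda>b. indicator X (a, b)))"
    by (rule expectation_pair_pmf_finite[OF assms])
  also have "(\<lambda>a. measure_pmf.expectation B (\<lambda>b. indicator X (a, b))) =
     (\<lambda>a. measure_pmf.expectation B (indicator {b. (a, b) \<in> X}))"
    by (intro ext Bochner_Integration.integral_cong) (auto simp: indicator_def)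
  finally show ?thesis by simp
qed

lemma expectation_pmf_mono:
  fixes f g :: "_ \<Rightarrow> real"
  assumes "finite (set_pmf A)" "\<And>a. a \<in> set_pmf A \<Longrightarrow> f a \<le> g a"
  shows "measure_pmf.expectation A f \<le> measure_pmf.expectation A g"
  using assms by (intro integral_mono_AE integrable_measure_pmf_finite) (auto simp: AE_measure_pmf_iff)

lemma prob_pair_pmf_le:
  assumes "finite (set_pmf A)" "finite (set_pmf B)"
    and "\<And>a. a \<in> set_pmf A \<Longrightarrow> measure_pmf.prob B {b. (a, b) \<in> X} \<le> c"
  shows "measure_pmf.prob (pair_pmf A B) X \<le> c"
proof -
  have "measure_pmf.prob (pair_pmf A B) X \<le> measure_pmf.expectation A (\<lambda>_. c)"
    unfolding prob_pair_pmf[OF assms(1,2)] by (rule expectation_pmf_mono) (use assms in auto)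
  then show ?thesis by simp
qed

lemma prob_pmf_markov:
  assumes "finite (set_pmf A)" "t > 0" "\<And>a. a \<in> set_pmf A \<Longrightarrow> f a \<ge> 0"
  shows "measure_pmf.prob A {a. t \<le> f a} \<le> measure_pmf.expectation A f / t"
proof -
  have "measure_pmf.prob A {a. t \<le> f a} = measure_pmf.expectation A (indicator {a. t \<le> f a})"
    by simp
  also have "\<dots> \<le> measure_pmf.expectation A (\<lambda>a. f a / t)"
    using assms by (intro expectation_pmf_mono) (auto simp: indicator_def)
  finally show ?thesis by simp
qed

definition signs :: "nat \<Rightarrow> (nat \<Rightarrow> real) pmf" where
  "signs m = Pi_pmf {..<m} 1 (\<lambda>_. pmf_of_set {-1, 1})"

definition hash :: "nat \<Rightarrow> nat \<Rightarrow> (nat \<Rightarrow> nat) pmf" where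
  "hash m N = Pi_pmf {..<m} 0 (\<lambda>_. pmf_of_set {..<N})"

lemma finite_set_Pi_pmf:
  assumes "finite A" "\<And>x. x \<in> A \<Longrightarrow> finite (set_pmf (p x))"
  shows "finite (set_pmf (Pi_pmf A d p))"
  using assms by (auto simp: set_Pi_pmf)

lemma finite_set_signs [simp]: "finite (set_pmf (signs m))"
  by (auto simp: signs_def intro!: finite_set_Pi_pmf)

lemma finite_set_hash [simp]: "N > 0 \<Longrightarrow> finite (set_pmf (hash m N))"
  by (auto simp: hash_def lessThan_empty_iff intro!: finite_set_Pi_pmf)

lemma set_signs: "s \<in> set_pmf (signs m) \<Longrightarrow> s i \<in> {-1, 1}"
  by (cases "i < m") (auto simp: signs_def set_Pi_pmf PiE_dflt_def)

lemma set_hash: "N > 0 \<Longrightarrow> u \<in> set_pmf (hash m N) \<Longrightarrow> u i < N"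
  by (cases "i < m") (auto simp: hash_def set_Pi_pmf PiE_dflt_def lessThan_empty_iff)

section \<open>Second moments of signed sums\<close>

text \<open>Cross terms vanish because the signs are independent with mean zero: in the induction
  the two values of the new sign cancel the mixed term.\<close>

lemma second_moment_signs_aux:
  fixes c :: "'a \<Rightarrow> real"
  assumes "finite A"
  shows "measure_pmf.expectation (Pi_pmf A d (\<lambda>_. pmf_of_set {-1, 1::real})) (\<lambda>s. (\<Sum>i\<in>A. c i * s i)\<^sup>2)
       = (\<Sum>i\<in>A. (c i)\<^sup>2)"
  using assms
proof (induction A)
  case (insert x A)
  let ?p = "pmf_of_set {-1, 1::real}" and ?R = "Pi_pmf A d (\<lambda>_. pmf_of_set {-1, 1::real})"
  have fin: "finite (set_pmf ?R)" using insert by (auto intro!: finite_set_Pi_pmf)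
  then have int: "integrable (measure_pmf ?R) f" for f :: "_ \<Rightarrow> real"
    by (rule integrable_measure_pmf_finite)
  have expand: "measure_pmf.expectation ?R (\<lambda>s. (b + S s)\<^sup>2)
      = b\<^sup>2 + 2 * b * measure_pmf.expectation ?R S + measure_pmf.expectation ?R (\<lambda>s. (S s)\<^sup>2)"
    for b :: real and S :: "_ \<Rightarrow> real"
  proof -
    have "measure_pmf.expectation ?R (\<lambda>s. (b + S s)\<^sup>2)
        = measure_pmf.expectation ?R (\<lambda>s. (b\<^sup>2 + 2 * b * S s) + (S s)\<^sup>2)"
      by (simp add: power2_eq_square algebra_simps)
    also have "\<dots> = b\<^sup>2 + 2 * b * measure_pmf.expectation ?R S + measure_pmf.expectation ?R (\<lambda>s. (S s)\<^sup>2)"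
      by (simp add: int)
    finally show ?thesis .
  qed
  have eq: "(\<Sum>i\<in>A. c i * (if i = x then y else s i)) = (\<Sum>i\<in>A. c i * s i)" for y s
    using insert by (intro sum.cong) auto
  have "measure_pmf.expectation (Pi_pmf (insert x A) d (\<lambda>_. ?p)) (\<lambda>s. (\<Sum>i\<in>insert x A. c i * s i)\<^sup>2)
     = measure_pmf.expectation ?p (\<lambda>y. measure_pmf.expectation ?R (\<lambda>s. (c x * y + (\<Sum>i\<in>A. c i * s i))\<^sup>2))"
    using insert fin
    by (simp add: Pi_pmf_insert expectation_pair_pmf_finite case_prod_unfold eq)
  also have "\<dots> = (\<Sum>y\<in>{-1, 1}. measure_pmf.expectation ?R (\<lambda>s. (c x * y + (\<Sum>i\<in>A. c i * s i))\<^sup>2)) / 2"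
    by (subst integral_pmf_of_set) auto
  also have "\<dots> = (\<Sum>y\<in>{-1, 1}. (c x * y)\<^sup>2 + 2 * (c x * y) * measure_pmf.expectation ?R (\<lambda>s. \<Sum>i\<in>A. c i * s i)
      + measure_pmf.expectation ?R (\<lambda>s. (\<Sum>i\<in>A. c i * s i)\<^sup>2)) / 2"
    by (intro arg_cong[where f = "\<lambda>t. t / 2"] sum.cong refl expand)
  also have "\<dots> = (c x)\<^sup>2 + (\<Sum>i\<in>A. (c i)\<^sup>2)"
    using insert by simp
  finally show ?case using insert by simp
qed simp

lemma prob_signs_chebyshev:
  assumes "h > 0"
  shows "measure_pmf.prob (signs m) {s. h \<le> \<bar>\<Sum>i<m. c i * s i\<bar>} \<le> (\<Sum>i<m. (c i)\<^sup>2) / h\<^sup>2"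
proof -
  have "{s. h \<le> \<bar>\<Sum>i<m. c i * s i\<bar>} = {s. h\<^sup>2 \<le> (\<Sum>i<m. c i * s i)\<^sup>2}"
    using assms by (auto simp flip: abs_le_square_iff)
  also have "measure_pmf.prob (signs m) \<dots> \<le> measure_pmf.expectation (signs m) (\<lambda>s. (\<Sum>i<m. c i * s i)\<^sup>2) / h\<^sup>2"
    using assms by (intro prob_pmf_markov) auto
  finally show ?thesis by (simp add: signs_def second_moment_signs_aux)
qed

text \<open>The coefficients may be random but are independent of the signs: Chebyshev's inequality
  for fixed \<open>a\<close> is averaged over \<open>A\<close>.\<close>

lemma prob_random_signs_chebyshev:
  assumes "h > 0" "finite (set_pmf A)"
  shows "measure_pmf.prob (pair_pmf A (signs m)) {w. h \<le> \<bar>\<Sum>i<m. c (fst w) i * snd w i\<bar>}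
     \<le> (\<Sum>i<m. measure_pmf.expectation A (\<lambda>a. (c a i)\<^sup>2)) / h\<^sup>2"
proof -
  have "measure_pmf.prob (pair_pmf A (signs m)) {w. h \<le> \<bar>\<Sum>i<m. c (fst w) i * snd w i\<bar>}
     = measure_pmf.expectation A (\<lambda>a. measure_pmf.prob (signs m) {s. h \<le> \<bar>\<Sum>i<m. c a i * s i\<bar>})"
    by (subst prob_pair_pmf) (use assms in auto)
  also have "\<dots> \<le> measure_pmf.expectation A (\<lambda>a. (\<Sum>i<m. (c a i)\<^sup>2) / h\<^sup>2)"
    using assms by (intro expectation_pmf_mono prob_signs_chebyshev) auto
  finally show ?thesis
    using assms by (simp add: integrable_measure_pmf_finite)
qed

section \<open>Hash collisions and majority votes\<close>

text \<open>With all other labels fixed, \<open>u i\<close> is uniform on \<open>{..<N}\<close>, and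
  since \<open>P dvd N\<close>, each residue class modulo \<open>P\<close> has \<open>N / P\<close>
  elements.\<close>

lemma prob_hash_collision:
  assumes "i < m" "j < m" "i \<noteq> j" "P dvd N" "N > 0"
  shows "measure_pmf.prob (hash m N) {u. u i mod P = u j mod P} \<le> 1 / P"
proof -
  from \<open>P dvd N\<close> obtain q where q: "N = P * q" by (elim dvdE)
  with \<open>N > 0\<close> have "P > 0" "q > 0" by auto
  let ?p = "pmf_of_set {..<N}" and ?A = "{..<m} - {i}"
  have N0: "{..<N} \<noteq> {}" using \<open>N > 0\<close> by (auto simp: lessThan_empty_iff)
  have "{..<m} = insert i ?A" using assms by auto
  then have "hash m N = map_pmf (\<lambda>(y, f). f(i := y)) (pair_pmf ?p (Pi_pmf ?A 0 (\<lambda>_. ?p)))"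
    unfolding hash_def using Pi_pmf_insert[of ?A i 0 "\<lambda>_. ?p"] by simp
  \<comment> \<open>The other labels become the first component, so that they can be fixed while the
    value at \<open>i\<close> stays random.\<close>
  also have "\<dots> = map_pmf (\<lambda>(f, y). f(i := y)) (pair_pmf (Pi_pmf ?A 0 (\<lambda>_. ?p)) ?p)"
    by (subst pair_commute_pmf) (simp add: pmf.map_comp o_def case_prod_unfold)
  finally have "measure_pmf.prob (hash m N) {u. u i mod P = u j mod P}
     = measure_pmf.prob (pair_pmf (Pi_pmf ?A 0 (\<lambda>_. ?p)) ?p) {w. snd w mod P = fst w j mod P}"
    using assms(3) by (simp add: vimage_def case_prod_unfold)
  also have "\<dots> \<le> 1 / P"
  proof (rule prob_pair_pmf_le)
    fix a :: "nat \<Rightarrow> nat"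
    let ?r = "a j mod P"
    have "{y. y < N \<and> y mod P = ?r} \<subseteq> (\<lambda>t. P * t + ?r) ` {..<q}"
    proof
      fix y assume y: "y \<in> {y. y < N \<and> y mod P = ?r}"
      then have "y = P * (y div P) + ?r" "y div P < q"
        using q \<open>P > 0\<close> by (auto simp: less_mult_imp_div_less mult.commute) (metis mult_div_mod_eq)
      then show "y \<in> (\<lambda>t. P * t + ?r) ` {..<q}" by blast
    qed
    then have card: "card {y. y < N \<and> y mod P = ?r} \<le> q"
      by (rule order.trans[OF card_mono[OF finite_imageI[OF finite_lessThan]]
            order.trans[OF card_image_le[OF finite_lessThan] eq_refl[OF card_lessThan]]])
    then show "measure_pmf.prob ?p {b. (a, b) \<in> {w. snd w mod P = fst w j mod P}} \<le> 1 / P"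
    proof -
      have "{..<N} \<inter> {b. b mod P = ?r} = {y. y < N \<and> y mod P = ?r}" by auto
      then show ?thesis using card N0 \<open>P > 0\<close> \<open>q > 0\<close>
        by (simp add: measure_pmf_of_set) (simp add: q divide_simps mult.commute flip: of_nat_mult)
    qed
  qed (use N0 in \<open>simp_all add: finite_set_Pi_pmf\<close>)
  finally show ?thesis .
qed

text \<open>A union bound over the \<open>R\<close>-element sets of repetitions: there are at most
  \<open>2 ^ (2 * R)\<close> of them, and by independence each is entirely bad with probability at
  most \<open>(1 / 16) ^ R\<close>.\<close>

lemma prob_majority:
  assumes "measure_pmf.prob q X \<le> 1 / 16"
  shows "measure_pmf.prob (Pi_pmf {..<2 * R} d (\<lambda>_. q)) {f. R \<le> card {r. r < 2 * R \<and> f r \<in> X}} \<le> (1 / 4) ^ R"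
proof -
  let ?M = "Pi_pmf {..<2 * R} d (\<lambda>_. q)"
  let ?F = "{A. A \<subseteq> {..<2 * R} \<and> card A = R}"
  have fin: "finite ?F" by (rule finite_subset[of _ "Pow {..<2 * R}"]) auto
  have *: "measure_pmf.prob ?M {f. \<forall>r\<in>A. f r \<in> X} \<le> (1 / 16) ^ R" if A: "A \<in> ?F" for A
  proof -
    have "measure_pmf.prob ?M {f. \<forall>r\<in>A. f r \<in> X}
        = measure_pmf.prob ?M (Pi {..<2 * R} (\<lambda>r. if r \<in> A then X else UNIV))"
      using A by (intro arg_cong[where f = "measure_pmf.prob ?M"]) (auto simp: Pi_def)
    also have "\<dots> = (\<Prod>r<2*R. if r \<in> A then measure_pmf.prob q X else 1)"
      by (subst measure_Pi_pmf_Pi) (auto intro!: prod.cong)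
    also have "\<dots> = measure_pmf.prob q X ^ R"
    proof -
      have "{..<2 * R} \<inter> {r. r \<in> A} = A" using A by auto
      then show ?thesis using A by (subst prod.If_cases) simp_all
    qed
    also have "\<dots> \<le> (1 / 16) ^ R" using assms by (intro power_mono) auto
    finally show ?thesis .
  qed
  have "{f. R \<le> card {r. r < 2 * R \<and> f r \<in> X}} \<subseteq> (\<Union>A\<in>?F. {f. \<forall>r\<in>A. f r \<in> X})"
  proof
    fix f assume "f \<in> {f. R \<le> card {r. r < 2 * R \<and> f r \<in> X}}"
    then have "R \<le> card {r. r < 2 * R \<and> f r \<in> X}" by simp
    then obtain A where "A \<subseteq> {r. r < 2 * R \<and> f r \<in> X}" "card A = R"
      by (rule obtain_subset_with_card_n)
    then show "f \<in> (\<Union>A\<in>?F. {f. \<forall>r\<in>A. f r \<in> X})" by auto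
  qed
  then have "measure_pmf.prob ?M {f. R \<le> card {r. r < 2 * R \<and> f r \<in> X}}
      \<le> measure_pmf.prob ?M (\<Union>A\<in>?F. {f. \<forall>r\<in>A. f r \<in> X})"
    by (intro measure_pmf.finite_measure_mono) auto
  also have "\<dots> \<le> (\<Sum>A\<in>?F. measure_pmf.prob ?M {f. \<forall>r\<in>A. f r \<in> X})"
    by (rule measure_pmf.finite_measure_subadditive_finite) (use fin in auto)
  also have "\<dots> \<le> real (card ?F) * (1 / 16) ^ R"
    using sum_mono[of ?F, OF *] by simp
  also have "\<dots> \<le> 2 ^ (2 * R) * (1 / 16) ^ R"
  proof -
    have "card ?F \<le> card (Pow {..<2 * R})" by (rule card_mono) auto
    then have "real (card ?F) \<le> real (2 ^ (2 * R))" by (simp only: card_Pow finite_lessThan card_lessThan of_nat_le_iff)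
    then show ?thesis by (intro mult_right_mono) auto
  qed
  also have "\<dots> = (2\<^sup>2 * (1 / 16)) ^ R" by (simp only: power_mult power_mult_distrib)
  also have "\<dots> = (1 / 4) ^ R" by simp
  finally show ?thesis .
qed

lemma prob_pair_pmf_fst:
  "measure_pmf.prob (pair_pmf A B) {w. fst w \<in> X} = measure_pmf.prob A X"
proof -
  have "measure_pmf.prob A X = measure_pmf.prob (map_pmf fst (pair_pmf A B)) X"
    by (simp add: map_fst_pair_pmf)
  then show ?thesis by (simp add: vimage_def)
qed

lemma prob_hash_eq:
  assumes "i < m" "j < m" "i \<noteq> j" "N > 0"
  shows "measure_pmf.prob (hash m N) {u. u i = u j} \<le> 1 / N"
proof -
  have "measure_pmf.prob (hash m N) {u. u i = u j} \<le> measure_pmf.prob (hash m N) {u. u i mod N = u j mod N}"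
    by (rule measure_pmf.finite_measure_mono) auto
  also have "\<dots> \<le> 1 / N" by (rule prob_hash_collision) (use assms in auto)
  finally show ?thesis .
qed

text \<open>A coordinate outside bucket \<open>j\<close> contributes at most \<open>min 1 ((z i)\<^sup>2 / h\<^sup>2) / B\<close>: the large ones by the
  probability of a collision, the small ones by their share in the variance.\<close>

lemma prob_sketch_noise:
  fixes z :: "nat \<Rightarrow> real"
  assumes h: "h > 0" and B: "B > 0" and bk: "\<And>i. i < m \<Longrightarrow> bk i < D" and j: "j < D"
    and v: "(\<Sum>i<m. if bk i = j then (z i)\<^sup>2 else 0) \<le> h\<^sup>2 / 32"
    and w: "(\<Sum>i<m. min 1 ((z i)\<^sup>2 / h\<^sup>2)) \<le> real B / 32"
  shows "measure_pmf.prob (pair_pmf (hash D B) (signs m))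
    {w. h \<le> \<bar>\<Sum>i<m. (if fst w (bk i) = fst w j then z i else 0) * snd w i\<bar>} \<le> 1 / 16"
    (is "measure_pmf.prob ?Q ?X \<le> _")
proof -
  define light where "light = {i. i < m \<and> \<bar>z i\<bar> < h}"
  define heavy where "heavy = {i. i < m \<and> \<not> \<bar>z i\<bar> < h}"
  have fin: "finite light" "finite heavy" by (auto simp: light_def heavy_def)
  define q where "q i = measure_pmf.prob (hash D B) {H. H (bk i) = H j}" for i
  have q1: "q i \<le> 1" for i by (simp add: q_def)
  have qB: "q i \<le> 1 / B" if "i < m" "bk i \<noteq> j" for i
    unfolding q_def by (rule prob_hash_eq) (use that bk j B in auto)
  define c where "c H i = (if H (bk i) = H j \<and> i \<in> light then z i else 0)" for H :: "nat \<Rightarrow> nat" and i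
  \<comment> \<open>Unless a heavy coordinate collides with \<open>j\<close>, only light coordinates
    enter the sum, with the coefficients \<open>c\<close>.\<close>
  have "?X \<subseteq> (\<Union>i\<in>heavy. {w. fst w \<in> {H. H (bk i) = H j}}) \<union> {w. h \<le> \<bar>\<Sum>i<m. c (fst w) i * snd w i\<bar>}"
  proof
    fix w assume wX: "w \<in> ?X"
    show "w \<in> (\<Union>i\<in>heavy. {w. fst w \<in> {H. H (bk i) = H j}}) \<union> {w. h \<le> \<bar>\<Sum>i<m. c (fst w) i * snd w i\<bar>}"
    proof (cases "\<exists>i\<in>heavy. fst w (bk i) = fst w j")
      case False
      then have "(\<Sum>i<m. (if fst w (bk i) = fst w j then z i else 0) * snd w i) = (\<Sum>i<m. c (fst w) i * snd w i)"
        by (intro sum.cong) (auto simp: c_def light_def heavy_def)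
      with wX show ?thesis by auto
    qed auto
  qed
  then have "measure_pmf.prob ?Q ?X \<le> measure_pmf.prob ?Q ((\<Union>i\<in>heavy. {w. fst w \<in> {H. H (bk i) = H j}}) \<union> {w. h \<le> \<bar>\<Sum>i<m. c (fst w) i * snd w i\<bar>})"
    by (intro measure_pmf.finite_measure_mono) auto
  also have "\<dots> \<le> measure_pmf.prob ?Q (\<Union>i\<in>heavy. {w. fst w \<in> {H. H (bk i) = H j}})
      + measure_pmf.prob ?Q {w. h \<le> \<bar>\<Sum>i<m. c (fst w) i * snd w i\<bar>}"
    by (rule measure_Un_le) auto
  also have "\<dots> \<le> (\<Sum>i\<in>heavy. q i) + (\<Sum>i\<in>light. (z i)\<^sup>2 / h\<^sup>2 * q i)"
  proof (rule add_mono)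
    have "measure_pmf.prob ?Q (\<Union>i\<in>heavy. {w. fst w \<in> {H. H (bk i) = H j}})
        \<le> (\<Sum>i\<in>heavy. measure_pmf.prob ?Q {w. fst w \<in> {H. H (bk i) = H j}})"
      by (rule measure_pmf.finite_measure_subadditive_finite) (use fin in auto)
    then show "measure_pmf.prob ?Q (\<Union>i\<in>heavy. {w. fst w \<in> {H. H (bk i) = H j}}) \<le> (\<Sum>i\<in>heavy. q i)"
      unfolding prob_pair_pmf_fst q_def .
  next
    have "measure_pmf.expectation (hash D B) (\<lambda>H. (c H i)\<^sup>2) = (if i \<in> light then (z i)\<^sup>2 * q i else 0)" for i
    proof -
      have "(\<lambda>H. (c H i)\<^sup>2) = (\<lambda>H. (if i \<in> light then (z i)\<^sup>2 else 0) * indicator {H. H (bk i) = H j} H)"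
        by (auto simp: c_def indicator_def)
      then show ?thesis by (simp add: q_def)
    qed
    then have "(\<Sum>i<m. measure_pmf.expectation (hash D B) (\<lambda>H. (c H i)\<^sup>2)) = (\<Sum>i\<in>light. (z i)\<^sup>2 * q i)"
      by (simp add: sum.If_cases light_def lessThan_def flip: Collect_conj_eq)
    then show "measure_pmf.prob ?Q {w. h \<le> \<bar>\<Sum>i<m. c (fst w) i * snd w i\<bar>} \<le> (\<Sum>i\<in>light. (z i)\<^sup>2 / h\<^sup>2 * q i)"
      using prob_random_signs_chebyshev[OF h, of "hash D B" m c] B by (simp add: sum_divide_distrib)
  qed
  also have "\<dots> = (\<Sum>i<m. if \<bar>z i\<bar> < h then (z i)\<^sup>2 / h\<^sup>2 * q i else q i)"
    by (simp add: sum.If_cases light_def heavy_def lessThan_def flip: Collect_conj_eq Collect_neg_eq)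
  also have "\<dots> \<le> (\<Sum>i<m. (if bk i = j then (z i)\<^sup>2 else 0) / h\<^sup>2 + min 1 ((z i)\<^sup>2 / h\<^sup>2) / B)"
  proof (rule sum_mono)
    fix i assume i: "i \<in> {..<m}"
    show "(if \<bar>z i\<bar> < h then (z i)\<^sup>2 / h\<^sup>2 * q i else q i)
       \<le> (if bk i = j then (z i)\<^sup>2 else 0) / h\<^sup>2 + min 1 ((z i)\<^sup>2 / h\<^sup>2) / B"
    proof (cases "\<bar>z i\<bar> < h")
      case True
      then have zh: "(z i)\<^sup>2 / h\<^sup>2 \<le> 1" using h by (simp add: abs_square_le_1 flip: power_divide)
      show ?thesis
      proof (cases "bk i = j")
        case True
        have "(z i)\<^sup>2 / h\<^sup>2 * q i \<le> (z i)\<^sup>2 / h\<^sup>2 * 1" by (intro mult_left_mono q1) auto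
        then show ?thesis using True \<open>\<bar>z i\<bar> < h\<close> B by (simp add: add_increasing2)
      next
        case False
        have "(z i)\<^sup>2 / h\<^sup>2 * q i \<le> (z i)\<^sup>2 / h\<^sup>2 * (1 / B)" by (intro mult_left_mono qB) (use i False in auto)
        then show ?thesis using False \<open>\<bar>z i\<bar> < h\<close> zh by simp
      qed
    next
      case False
      then have zh: "h\<^sup>2 \<le> (z i)\<^sup>2" using h by (simp flip: abs_le_square_iff)
      \<comment> \<open>A heavy coordinate in bucket \<open>j\<close> would by itself exceed the
        energy allowed by \<open>v\<close>.\<close>
      have "bk i \<noteq> j"
      proof
        assume "bk i = j"
        then have "(z i)\<^sup>2 \<le> (\<Sum>i<m. if bk i = j then (z i)\<^sup>2 else 0)"
          using member_le_sum[of i "{..<m}" "\<lambda>i. if bk i = j then (z i)\<^sup>2 else 0"] i by simp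
        with v zh have "h\<^sup>2 \<le> h\<^sup>2 / 32" by linarith
        with h show False by simp
      qed
      with qB[of i] i False h zh show ?thesis by simp
    qed
  qed
  also have "\<dots> = (\<Sum>i<m. if bk i = j then (z i)\<^sup>2 else 0) / h\<^sup>2 + (\<Sum>i<m. min 1 ((z i)\<^sup>2 / h\<^sup>2)) / B"
    by (simp add: sum.distrib sum_divide_distrib)
  \<comment> \<open>Own bucket and foreign buckets contribute \<open>1 / 32\<close> each, which
    gives the \<open>1 / 16\<close> required by \<open>prob_majority\<close>.\<close>
  also have "\<dots> \<le> (h\<^sup>2 / 32) / h\<^sup>2 + (real B / 32) / B"
    using v w h B by (intro add_mono divide_right_mono) auto
  also have "\<dots> = 1 / 16" using h B by simp
  finally show ?thesis .
qed

text \<open>The weight \<open>a\<close> may depend on the same labels as the collision, as the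
  digits do; replacing it by the constant \<open>b\<close> removes this dependence.\<close>

lemma expectation_hash_collision:
  assumes "i < m" "l < m" "l \<noteq> i" "P dvd N" "N > 0" "\<And>u. 0 \<le> a u \<and> a u \<le> b"
  shows "measure_pmf.expectation (hash m N) (\<lambda>u. if u l mod P = u i mod P then a u else 0) \<le> b / P"
proof -
  have "measure_pmf.expectation (hash m N) (\<lambda>u. if u l mod P = u i mod P then a u else 0)
     \<le> measure_pmf.expectation (hash m N) (\<lambda>u. b * indicator {u. u l mod P = u i mod P} u)"
    by (rule expectation_pmf_mono) (use assms in \<open>auto simp: indicator_def\<close>)
  also have "\<dots> = b * measure_pmf.prob (hash m N) {u. u l mod P = u i mod P}"
    by simp
  also have "\<dots> \<le> b * (1 / P)"
    \<comment> \<open>\<open>b\<close> is nonnegative because it bounds the nonnegative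
      \<open>a\<close> at the arbitrary argument \<open>undefined\<close>.\<close>
    using assms order.trans[of 0 "a undefined" b] by (intro mult_left_mono prob_hash_collision) auto
  finally show ?thesis by simp
qed

text \<open>Coordinate \<open>i\<close> is the signal, the others in its residue class are noise.
  Each of them falls into that class with probability at most \<open>1 / P\<close>, so the mean
  variance of the signed sum is at most \<open>b\<^sup>2 / P\<close>.\<close>

lemma prob_locate_noise:
  fixes x :: "nat \<Rightarrow> real"
  assumes h: "h > 0" and i: "i < m" and P: "P dvd N" and N: "N > 0"
    and d: "\<And>u l. \<bar>d u l\<bar> \<le> b" and x: "(\<Sum>l<m. (x l)\<^sup>2) \<le> 1"
  shows "measure_pmf.prob (pair_pmf (hash m N) (signs m))
    {w. h \<le> \<bar>\<Sum>l<m. (if l \<noteq> i \<and> fst w l mod P = fst w i mod P then d (fst w) l * x l else 0) * snd w l\<bar>}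
     \<le> b\<^sup>2 / (P * h\<^sup>2)"
proof -
  let ?c = "\<lambda>u l. if l \<noteq> i \<and> u l mod P = u i mod P then d u l * x l else 0"
  have "measure_pmf.prob (pair_pmf (hash m N) (signs m)) {w. h \<le> \<bar>\<Sum>l<m. ?c (fst w) l * snd w l\<bar>}
    \<le> (\<Sum>l<m. measure_pmf.expectation (hash m N) (\<lambda>u. (?c u l)\<^sup>2)) / h\<^sup>2"
    by (rule prob_random_signs_chebyshev) (use h N in auto)
  also have "\<dots> \<le> (\<Sum>l<m. b\<^sup>2 * (x l)\<^sup>2 / P) / h\<^sup>2"
  proof (intro divide_right_mono sum_mono)
    fix l assume l: "l \<in> {..<m}"
    show "measure_pmf.expectation (hash m N) (\<lambda>u. (?c u l)\<^sup>2) \<le> b\<^sup>2 * (x l)\<^sup>2 / P"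
    proof (cases "l = i")
      case False
      then have "(\<lambda>u. (?c u l)\<^sup>2) = (\<lambda>u. if u l mod P = u i mod P then (d u l)\<^sup>2 * (x l)\<^sup>2 else 0)"
        by (auto simp: power_mult_distrib)
      moreover have "(d u l)\<^sup>2 \<le> b\<^sup>2" for u
        using d[of u l] by (metis abs_ge_zero power2_abs power_mono)
      ultimately show ?thesis
        using expectation_hash_collision[of i m l P N "\<lambda>u. (d u l)\<^sup>2 * (x l)\<^sup>2" "b\<^sup>2 * (x l)\<^sup>2"] i l P N False
        by (simp add: mult_right_mono)
    qed simp
  qed simp
  also have "\<dots> = b\<^sup>2 / (P * h\<^sup>2) * (\<Sum>l<m. (x l)\<^sup>2)"
    by (simp add: sum_distrib_left flip: sum_divide_distrib)
  also have "\<dots> \<le> b\<^sup>2 / (P * h\<^sup>2) * 1" using x by (intro mult_left_mono) auto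
  finally show ?thesis by simp
qed

text \<open>Markov's inequality for the energy that the other coordinates bring into the class of
  \<open>i\<close>, whose mean is at most \<open>1 / P\<close>.\<close>

lemma prob_not_isolated:
  fixes x :: "nat \<Rightarrow> real"
  assumes t: "t > 0" and i: "i < m" and P: "P dvd N" and N: "N > 0" and x: "(\<Sum>l<m. (x l)\<^sup>2) \<le> 1"
  shows "measure_pmf.prob (hash m N)
    {u. t \<le> (\<Sum>l<m. if l \<noteq> i \<and> u l mod P = u i mod P then (x l)\<^sup>2 else 0)} \<le> 1 / (P * t)"
proof -
  let ?c = "\<lambda>u l. if l \<noteq> i \<and> u l mod P = u i mod P then (x l)\<^sup>2 else 0"
  have "measure_pmf.prob (hash m N) {u. t \<le> (\<Sum>l<m. ?c u l)}
    \<le> measure_pmf.expectation (hash m N) (\<lambda>u. \<Sum>l<m. ?c u l) / t"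
    by (rule prob_pmf_markov) (use t N in \<open>auto intro!: sum_nonneg\<close>)
  also have "\<dots> = (\<Sum>l<m. measure_pmf.expectation (hash m N) (\<lambda>u. ?c u l)) / t"
    using N by (subst Bochner_Integration.integral_sum) (auto simp: integrable_measure_pmf_finite)
  also have "\<dots> \<le> (\<Sum>l<m. (x l)\<^sup>2 / P) / t"
  proof (intro divide_right_mono sum_mono)
    fix l assume l: "l \<in> {..<m}"
    show "measure_pmf.expectation (hash m N) (\<lambda>u. ?c u l) \<le> (x l)\<^sup>2 / P"
      using expectation_hash_collision[of i m l P N "\<lambda>u. (x l)\<^sup>2" "(x l)\<^sup>2"] i l P N
      by (cases "l = i") auto
  qed (use t in simp)
  also have "\<dots> = 1 / (P * t) * (\<Sum>l<m. (x l)\<^sup>2)"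
    by (simp add: sum_divide_distrib[symmetric])
  also have "\<dots> \<le> 1 / (P * t) * 1" using x t by (intro mult_left_mono) auto
  finally show ?thesis by simp
qed

lemma prob_not_injective:
  assumes "i < m" "N > 0"
  shows "measure_pmf.prob (hash m N) {u. \<exists>l<m. l \<noteq> i \<and> u l = u i} \<le> m / N"
proof -
  have "{u. \<exists>l<m. l \<noteq> i \<and> u l = u i} = (\<Union>l\<in>{..<m} - {i}. {u. u l = u i})" by auto
  also have "measure_pmf.prob (hash m N) \<dots> \<le> (\<Sum>l\<in>{..<m} - {i}. measure_pmf.prob (hash m N) {u. u l = u i})"
    by (rule measure_pmf.finite_measure_subadditive_finite) auto
  also have "\<dots> \<le> (\<Sum>l\<in>{..<m} - {i}. 1 / N)"
    by (intro sum_mono prob_hash_eq) (use assms in auto)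
  also have "\<dots> \<le> m / N" using assms by (simp add: divide_right_mono)
  finally show ?thesis .
qed

text \<open>Each counted bucket has capped weight at least \<open>1 / 32\<close>: either it contains
  a coordinate of weight \<open>1\<close>, or no cap is active and its weight is its energy divided
  by \<open>h\<^sup>2\<close>. Distinct buckets are disjoint.\<close>

lemma card_heavy_buckets:
  fixes x :: "nat \<Rightarrow> real" and D :: nat
  assumes h: "h > 0"
  shows "real (card {j. j < D \<and> h\<^sup>2 / 32 < (\<Sum>l<m. if bk l = j then (x l)\<^sup>2 else 0)})
     \<le> 32 * (\<Sum>l<m. min 1 ((x l)\<^sup>2 / h\<^sup>2))" (is "real (card ?G) \<le> 32 * (\<Sum>l<m. ?w l)")
proof -
  have w0: "0 \<le> ?w l" for l by simp
  have fin: "finite ?G" by (rule finite_subset[of _ "{..<D}"]) auto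
  have *: "1 / 32 \<le> (\<Sum>l<m. if bk l = j then ?w l else 0)" if j: "j \<in> ?G" for j
  proof (cases "\<exists>l<m. bk l = j \<and> h\<^sup>2 \<le> (x l)\<^sup>2")
    case True
    then obtain l where l: "l < m" "bk l = j" "h\<^sup>2 \<le> (x l)\<^sup>2" by blast
    then have "1 = ?w l" using h by simp
    also have "\<dots> \<le> (\<Sum>l<m. if bk l = j then ?w l else 0)"
      using member_le_sum[of l "{..<m}" "\<lambda>l. if bk l = j then ?w l else 0"] l w0 by simp
    finally show ?thesis by simp
  next
    case False
    then have "(\<Sum>l<m. if bk l = j then ?w l else 0) = (\<Sum>l<m. (if bk l = j then (x l)\<^sup>2 else 0) / h\<^sup>2)"
      using h by (intro sum.cong) (auto simp: min_def)
    also have "\<dots> = (\<Sum>l<m. if bk l = j then (x l)\<^sup>2 else 0) / h\<^sup>2"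
      by (simp add: sum_divide_distrib)
    also have "\<dots> \<ge> (h\<^sup>2 / 32) / h\<^sup>2" using j by (intro divide_right_mono) auto
    finally show ?thesis using h by simp
  qed
  have "card ?G / 32 = (\<Sum>j\<in>?G. 1 / 32)" by simp
  also have "\<dots> \<le> (\<Sum>j\<in>?G. \<Sum>l<m. if bk l = j then ?w l else 0)" by (intro sum_mono *)
  also have "\<dots> = (\<Sum>l<m. \<Sum>j\<in>?G. if bk l = j then ?w l else 0)" by (rule sum.swap)
  also have "\<dots> \<le> (\<Sum>l<m. ?w l)"
    using fin by (intro sum_mono) (simp only: sum.delta', auto)
  finally show ?thesis by simp
qed

section \<open>The recovery algorithm\<close>

text \<open>At level \<open>r\<close> the label is known modulo \<open>n ^ expo r\<close>, and the
  next radix is \<open>n ^ (expo r div 4)\<close>. The square of this radix is at most the square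
  root of the modulus, which leaves room to suppress the digit noise.\<close>

primrec expo :: "nat \<Rightarrow> nat" where
  "expo 0 = 8"
| "expo (Suc r) = expo r + expo r div 4"

lemma expo_ge: "8 + 2 * r \<le> expo r"
proof (induction r)
  case (Suc r)
  then have "2 \<le> expo r div 4" by linarith
  with Suc show ?case by simp
qed simp

lemma expo_mono: "r \<le> r' \<Longrightarrow> expo r \<le> expo r'"
  by (induction rule: dec_induct) auto

lemma sum_half_powers_le: "(\<Sum>r<T. (1 / 2) ^ r) \<le> (2::real)"
proof -
  have "(\<Sum>r<T. (1 / 2) ^ r) = 2 - 2 * (1 / 2 :: real) ^ T"
    by (induction T) auto
  then show ?thesis by simp
qed

text \<open>Rounding in \<open>div 4\<close> lowers the growth factor from \<open>5 / 4\<close> to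
  \<open>8 / 7\<close>: \<open>4 * q + c\<close> with \<open>c \<le> 3\<close> and
  \<open>q \<ge> 1\<close> is at most \<open>7 * q\<close>.\<close>

lemma expo_growth: "8 * (8 / 7 :: real) ^ r \<le> expo r"
proof (induction r)
  case (Suc r)
  have "expo r \<le> 7 * (expo r div 4)" using expo_ge[of r] by linarith
  then have "real (expo r) \<le> 7 * real (expo r div 4)" by (metis of_nat_le_iff of_nat_mult of_nat_numeral)
  with Suc show ?case by simp
qed simp

text \<open>For each repetition, a hash function from buckets to cells and signs for the
  coordinates.\<close>

type_synonym sketch_seed = "nat \<Rightarrow> (nat \<Rightarrow> nat) \<times> (nat \<Rightarrow> real)"

text \<open>
  The vector lives in \<open>\<real>\<^sup>m\<close>, at most \<open>k = h powr - p\<close> of its coordinates are of size \<open>h\<close> or more, \<open>2 * R\<close> is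
  the number of repetitions of the sketch, \<open>T\<close> the number of refinement levels, and \<open>\<eta>\<close> the width to
  which measured values are rounded.
\<close>

locale recovery =
  fixes m n k R T :: nat and h \<eta> :: real
  assumes n2: "2 \<le> n" and k1: "1 \<le> k" and kn: "k \<le> n"
    and h: "1 / n \<le> h"
    and R: "n ^ 9 \<le> 4 ^ R" and T: "m * n\<^sup>2 \<le> n ^ expo T"
    and eta: "0 < \<eta>" "\<eta> \<le> h / 4" "\<And>r. r < T \<Longrightarrow> \<eta> * (1 + n ^ (expo r div 4)) \<le> h / 4"
begin

definition P :: "nat \<Rightarrow> nat" where "P r = n ^ expo r"
definition B :: "nat \<Rightarrow> nat" where "B r = n ^ (expo r div 4)"

lemma P_Suc: "P (Suc r) = P r * B r"
  by (simp add: P_def B_def power_add)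

lemma P_pos: "P r > 0" and B_pos: "B r > 0"
  using n2 by (simp_all add: P_def B_def)

lemma P_dvd: "r \<le> r' \<Longrightarrow> P r dvd P r'"
  by (induction rule: dec_induct) (auto simp: P_Suc)

lemma h_pos: "h > 0"
  using h n2 by (smt (verit) divide_pos_pos of_nat_0_less_iff zero_less_one pos2 order_less_le_trans)

definition bucket :: "(nat \<Rightarrow> nat) \<Rightarrow> nat \<Rightarrow> nat" where
  "bucket U l = U l mod P 0"

definition digit :: "(nat \<Rightarrow> nat) \<Rightarrow> nat \<Rightarrow> nat \<Rightarrow> nat" where
  "digit U r l = U l div P r mod B r"

lemma mod_P_Suc: "U l mod P (Suc r) = U l mod P r + P r * digit U r l"
  by (simp add: P_Suc mod_mult2_eq digit_def)

lemma digit_less: "digit U r l < B r"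
  using B_pos by (simp add: digit_def)

section \<open>The algorithm as a decision tree\<close>

text \<open>Rows are repetitions, columns are cells. With \<open>32 * k\<close> cells, capped weight
  at most \<open>k\<close> meets the condition \<open>w\<close> of
  \<open>prob_sketch_noise\<close>.\<close>

definition sketch :: "(nat \<Rightarrow> nat) \<Rightarrow> sketch_seed \<Rightarrow> int list list prog" where
  "sketch U g = mapM (\<lambda>r. mapM (\<lambda>b.
     Query (\<lambda>l. if fst (g r) (bucket U l) = b then snd (g r) l else 0) Return) [0..<32 * k]) [0..<2 * R]"

text \<open>The filter over all buckets is postprocessing and costs no measurement. The threshold
  \<open>2 * h\<close> separates noise below \<open>h\<close> from a signal of at least
  \<open>4 * h\<close> disturbed by less than \<open>h\<close>, with rounding included.\<close>

definition candidates :: "sketch_seed \<Rightarrow> int list list \<Rightarrow> nat list" where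
  "candidates g tab =
     filter (\<lambda>j. R < card {r. r < 2 * R \<and> 2 * h \<le> \<bar>\<eta> * real_of_int (tab ! r ! fst (g r) j)\<bar>}) [0..<P 0]"

text \<open>The invariant is that \<open>u\<close> is the label modulo \<open>P r\<close>. The sign
  and the value of the dominating coordinate cancel in the quotient of the two answers, and so does
  the rounding unit, leaving the next digit.\<close>

primrec descend :: "(nat \<Rightarrow> nat) \<Rightarrow> (nat \<Rightarrow> real) \<Rightarrow> nat \<Rightarrow> nat \<Rightarrow> nat prog" where
  "descend U s j 0 = Return j"
| "descend U s j (Suc r) = bind_prog (descend U s j r) (\<lambda>u.
     Query (\<lambda>l. if U l mod P r = u then s l else 0) (\<lambda>a.
     Query (\<lambda>l. if U l mod P r = u then real (digit U r l) * s l else 0) (\<lambda>b.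
     Return (u + P r * nat (round (real_of_int b / real_of_int a))))))"

text \<open>If no coordinate has the label found, \<open>SOME\<close> yields an arbitrary number, which does no harm because
  the value returned with it is the measured one.\<close>

definition locate :: "(nat \<Rightarrow> nat) \<Rightarrow> (nat \<Rightarrow> real) \<Rightarrow> nat \<Rightarrow> (nat \<times> int) prog" where
  "locate U s j = bind_prog (descend U s j T) (\<lambda>u.
     let i = (SOME i. i < m \<and> U i = u) in Query (\<lambda>l. if l = i then 1 else 0) (\<lambda>v. Return (i, v)))"

text \<open>The truncation bounds the cost for every seed; in the successful case it cuts nothing
  off.\<close>

definition alg :: "((nat \<Rightarrow> nat) \<times> (nat \<Rightarrow> real)) \<times> sketch_seed \<Rightarrow> (nat \<Rightarrow> real) prog" where
  "alg = (\<lambda>((U, s), g). bind_prog (sketch U g) (\<lambda>tab.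
     bind_prog (mapM (locate U s) (take (32 * k) (candidates g tab))) (\<lambda>found.
     Return (\<lambda>i. case map_of found i of None \<Rightarrow> 0 | Some v \<Rightarrow> \<eta> * real_of_int v))))"

section \<open>Number of measurements\<close>

lemma cost_descend: "cost_le (2 * r) (descend U s j r)"
proof (induction r)
  case (Suc r)
  have "cost_le (2 * r + Suc (Suc 0)) (descend U s j (Suc r))"
    unfolding descend.simps by (intro cost_le_bind Suc cost_le.intros)
  then show ?case by simp
qed (auto intro: cost_le.intros)

lemma cost_locate: "cost_le (2 * T + 1) (locate U s j)"
  unfolding locate_def Let_def One_nat_def by (intro cost_le_bind cost_descend cost_le.intros)

lemma cost_alg: "cost_le (2 * R * (32 * k) + 32 * k * (2 * T + 1)) (alg w)"
proof -
  obtain U s g where w: "w = ((U, s), g)" by (metis surj_pair)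
  have "cost_le (length [0..<2 * R] * (length [0..<32 * k] * 1)) (sketch U g)"
    unfolding sketch_def One_nat_def by (intro cost_le_mapM cost_le.intros)
  then have s: "cost_le (2 * R * (32 * k)) (sketch U g)" by simp
  have l: "cost_le (32 * k * (2 * T + 1)) (mapM (locate U s) (take (32 * k) js))" for js
    by (rule cost_le_mono[OF cost_le_mapM[OF cost_locate]], rule mult_le_mono1) simp
  have "cost_le (2 * R * (32 * k) + (32 * k * (2 * T + 1) + 0)) (alg w)"
    unfolding w alg_def prod.case by (intro cost_le_bind s l cost_le.intros)
  then show ?thesis by simp
qed

section \<open>Correctness outside the failure events\<close>

lemma floor_eta: "\<bar>\<eta> * \<lfloor>y / \<eta>\<rfloor> - y\<bar> \<le> \<eta>"
proof -
  define q where "q = real_of_int \<lfloor>y / \<eta>\<rfloor>"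
  have "q \<le> y / \<eta>" "y / \<eta> < q + 1" unfolding q_def by linarith+
  then have "\<eta> * q \<le> y" "y < \<eta> * q + \<eta>"
    using eta(1) by (simp_all add: field_simps)
  then show ?thesis by (simp add: q_def)
qed

lemma lin_unit: "i < m \<Longrightarrow> lin m (\<lambda>l. if l = i then 1 else 0) x = x i"
  by (simp add: lin_def if_distrib[of "\<lambda>c. c * _"] cong: if_cong)

text \<open>Dividing the hypothesis by \<open>\<bar>\<eta> * a\<bar>\<close> puts the quotient
  within \<open>1 / 2\<close> of \<open>d\<close>.\<close>

lemma round_ratio:
  fixes a b :: int and d :: nat
  assumes "2 * \<bar>\<eta> * b - d * (\<eta> * a)\<bar> < \<bar>\<eta> * a\<bar>"
  shows "nat (round (real_of_int b / real_of_int a)) = d"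
proof -
  have a: "a \<noteq> 0" using assms by auto
  have "\<eta> * b - d * (\<eta> * a) = \<eta> * (b - d * a)" by (simp add: algebra_simps)
  then have "2 * \<bar>b - d * a\<bar> < \<bar>real_of_int a\<bar>"
    using assms eta(1) by (simp add: abs_mult)
  moreover have "real_of_int b / a - d = (b - d * a) / a"
    using a by (simp add: diff_divide_distrib)
  ultimately have "\<bar>real_of_int b / a - d\<bar> < 1 / 2"
    using a by (simp add: field_simps)
  then have "round (real_of_int b / a) = int d"
    by (intro round_unique') auto
  then show ?thesis by simp
qed

text \<open>The factor \<open>1\<close> gives both noise terms the shape required by \<open>prob_locate_noise\<close>.\<close>

definition level_noise :: "(nat \<Rightarrow> nat) \<Rightarrow> (nat \<Rightarrow> real) \<Rightarrow> (nat \<Rightarrow> real) \<Rightarrow> nat \<Rightarrow> nat \<Rightarrow> real" where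
  "level_noise U s x i r = (\<Sum>l<m. (if l \<noteq> i \<and> U l mod P r = U i mod P r then 1 * x l else 0) * s l)"

definition digit_noise :: "(nat \<Rightarrow> nat) \<Rightarrow> (nat \<Rightarrow> real) \<Rightarrow> (nat \<Rightarrow> real) \<Rightarrow> nat \<Rightarrow> nat \<Rightarrow> real" where
  "digit_noise U s x i r = (\<Sum>l<m. (if l \<noteq> i \<and> U l mod P r = U i mod P r
     then (real (digit U r l) - real (digit U r i)) * x l else 0) * s l)"

text \<open>The noise is taken over the true residue classes of \<open>U i\<close>, not over those
  computed from answers. Adaptivity therefore creates no dependence, and one draw of
  \<open>s\<close> serves all levels.\<close>

definition locatable :: "(nat \<Rightarrow> nat) \<Rightarrow> (nat \<Rightarrow> real) \<Rightarrow> (nat \<Rightarrow> real) \<Rightarrow> nat \<Rightarrow> bool" where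
  "locatable U s x i \<longleftrightarrow>
     (\<forall>r<T. \<not> h \<le> \<bar>level_noise U s x i r\<bar> \<and> \<not> h \<le> \<bar>digit_noise U s x i r\<bar>) \<and>
     \<not> (\<exists>l<m. l \<noteq> i \<and> U l = U i)"

lemma descend_correct:
  assumes s: "\<And>l. s l \<in> {-1, 1}" and i: "i < m" and xi: "4 * h \<le> \<bar>x i\<bar>" and loc: "locatable U s x i"
  shows "r \<le> T \<Longrightarrow> run m \<eta> x (descend U s (bucket U i) r) = U i mod P r"
proof (induction r)
  case (Suc r)
  let ?d = "digit U r i"
  let ?ya = "lin m (\<lambda>l. if U l mod P r = U i mod P r then s l else 0) x"
  let ?yb = "lin m (\<lambda>l. if U l mod P r = U i mod P r then real (digit U r l) * s l else 0) x"
  let ?a = "\<lfloor>?ya / \<eta>\<rfloor>" and ?b = "\<lfloor>?yb / \<eta>\<rfloor>"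
  have N: "\<bar>level_noise U s x i r\<bar> < h" "\<bar>digit_noise U s x i r\<bar> < h"
    using loc Suc.prems by (auto simp: locatable_def not_le)
  have "?ya = (\<Sum>l<m. (if l = i then s i * x i else 0)
      + (if l \<noteq> i \<and> U l mod P r = U i mod P r then 1 * x l else 0) * s l)"
    unfolding lin_def by (intro sum.cong) auto
  then have ya: "?ya = s i * x i + level_noise U s x i r"
    using i by (simp add: sum.distrib level_noise_def)
  \<comment> \<open>Subtracting \<open>?d\<close> times the plain sum cancels coordinate
    \<open>i\<close>, whose digit is \<open>?d\<close>.\<close>
  have "?yb - ?d * ?ya = digit_noise U s x i r"
    unfolding lin_def digit_noise_def sum_distrib_left sum_subtractf[symmetric]
    by (intro sum.cong) (auto simp: algebra_simps)
  then have 1: "\<bar>?yb - ?d * ?ya\<bar> < h" using N by simp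
  have "\<bar>s i * x i\<bar> = \<bar>x i\<bar>" using s[of i] by (auto simp: abs_mult)
  then have 2: "\<bar>?ya\<bar> > 3 * h" using ya N xi by linarith
  have e: "\<bar>\<eta> * ?a - ?ya\<bar> \<le> \<eta>" "\<bar>\<eta> * ?b - ?yb\<bar> \<le> \<eta>" by (rule floor_eta)+
  have "\<bar>?d * (\<eta> * ?a) - ?d * ?ya\<bar> \<le> ?d * \<eta>"
    using mult_left_mono[OF e(1), of "real ?d"] by (simp add: abs_mult flip: right_diff_distrib)
  moreover have "?d * \<eta> \<le> B r * \<eta>"
    using digit_less[of U r i] eta(1) by (intro mult_right_mono) auto
  ultimately have "\<bar>\<eta> * ?b - ?d * (\<eta> * ?a)\<bar> < h + \<eta> * (1 + B r)"
    using 1 e(2) by (simp add: algebra_simps)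
  also have "\<dots> \<le> h + h / 4" using eta(3)[of r] Suc.prems by (simp add: B_def)
  finally have 3: "\<bar>\<eta> * ?b - ?d * (\<eta> * ?a)\<bar> < h + h / 4" .
  \<comment> \<open>Twice the error is below \<open>5 / 2 * h\<close>, while the rounded signal
    exceeds \<open>3 * h - \<eta>\<close> and thus \<open>11 / 4 * h\<close>.\<close>
  have aux: "2 * \<beta> < \<bar>\<alpha>\<bar>" if "\<beta> < h + h / 4" "\<bar>y\<bar> > 3 * h" "\<bar>\<alpha> - y\<bar> \<le> \<eta>" for \<alpha> \<beta> y :: real
    using that eta(2) h_pos by linarith
  have "2 * \<bar>\<eta> * ?b - ?d * (\<eta> * ?a)\<bar> < \<bar>\<eta> * ?a\<bar>"
    by (rule aux[OF 3 2 e(1)])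
  then have "nat (round (real_of_int ?b / real_of_int ?a)) = ?d"
    by (rule round_ratio)
  then show ?case using Suc by (simp add: mod_P_Suc)
qed (simp add: bucket_def)

lemma locate_correct:
  assumes s: "\<And>l. s l \<in> {-1, 1}" and i: "i < m" and xi: "4 * h \<le> \<bar>x i\<bar>" and loc: "locatable U s x i"
    and U: "\<And>l. U l < P T"
  shows "run m \<eta> x (locate U s (bucket U i)) = (i, \<lfloor>x i / \<eta>\<rfloor>)"
proof -
  have "(SOME l. l < m \<and> U l = U i) = i"
    by (rule some_equality) (use loc i in \<open>auto simp: locatable_def\<close>)
  then show ?thesis
    using descend_correct[OF s i xi loc, of T] U i by (simp add: locate_def lin_unit Let_def)
qed

lemma run_locate_value:
  assumes "run m \<eta> x (locate U s j) = (i, v)" "i < m"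
  shows "v = \<lfloor>x i / \<eta>\<rfloor>"
  using assms by (auto simp: locate_def Let_def lin_unit)

text \<open>For \<open>z = x\<close> this is the exact sketch answer, for
  \<open>z = x(i := 0)\<close> the disturbance of coordinate \<open>i\<close>.\<close>

definition sketch_noise :: "(nat \<Rightarrow> nat) \<Rightarrow> sketch_seed \<Rightarrow> (nat \<Rightarrow> real) \<Rightarrow> nat \<Rightarrow> nat \<Rightarrow> real" where
  "sketch_noise U g z j r =
     (\<Sum>l<m. (if fst (g r) (bucket U l) = fst (g r) j then z l else 0) * snd (g r) l)"

definition sketch_ok :: "(nat \<Rightarrow> nat) \<Rightarrow> sketch_seed \<Rightarrow> (nat \<Rightarrow> real) \<Rightarrow> nat \<Rightarrow> bool" where
  "sketch_ok U g z j \<longleftrightarrow> \<not> R \<le> card {r. r < 2 * R \<and> h \<le> \<bar>sketch_noise U g z j r\<bar>}"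

definition energy :: "(nat \<Rightarrow> nat) \<Rightarrow> (nat \<Rightarrow> real) \<Rightarrow> nat \<Rightarrow> real" where
  "energy U z j = (\<Sum>l<m. if bucket U l = j then (z l)\<^sup>2 else 0)"

lemma sketch_entry:
  assumes "r < 2 * R" "fst (g r) j < 32 * k"
  shows "run m \<eta> x (sketch U g) ! r ! fst (g r) j = \<lfloor>sketch_noise U g x j r / \<eta>\<rfloor>"
  using assms by (auto simp: sketch_def sketch_noise_def lin_def intro!: arg_cong[where f = floor] arg_cong[where f = "\<lambda>t. t / \<eta>"] sum.cong)

text \<open>A vote forces an exact answer of size at least \<open>2 * h - \<eta>\<close>, hence at
  least \<open>h\<close>.\<close>

lemma candidate_imp:
  assumes g: "\<And>r j. r < 2 * R \<Longrightarrow> fst (g r) j < 32 * k"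
    and j: "j \<in> set (candidates g (run m \<eta> x (sketch U g)))"
  shows "j < P 0 \<and> \<not> sketch_ok U g x j"
proof -
  let ?S = "{r. r < 2 * R \<and> 2 * h \<le> \<bar>\<eta> * real_of_int (run m \<eta> x (sketch U g) ! r ! fst (g r) j)\<bar>}"
  have "?S \<subseteq> {r. r < 2 * R \<and> h \<le> \<bar>sketch_noise U g x j r\<bar>}"
  proof safe
    fix r assume r: "r < 2 * R" and *: "2 * h \<le> \<bar>\<eta> * real_of_int (run m \<eta> x (sketch U g) ! r ! fst (g r) j)\<bar>"
    show "h \<le> \<bar>sketch_noise U g x j r\<bar>"
      using * floor_eta[of "sketch_noise U g x j r"] eta(2) h_pos
      unfolding sketch_entry[of r g j, OF r g[OF r]] by linarith
  qed
  then have "card ?S \<le> card {r. r < 2 * R \<and> h \<le> \<bar>sketch_noise U g x j r\<bar>}"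
    by (rule card_mono[rotated]) simp
  moreover have "R < card ?S" "j < P 0" using j by (auto simp: candidates_def)
  ultimately show ?thesis by (auto simp: sketch_ok_def)
qed

text \<open>Every repetition votes for the bucket or is disturbed, because
  \<open>4 * h - h - \<eta>\<close> exceeds \<open>2 * h\<close>; fewer than \<open>R\<close>
  disturbed ones leave more than \<open>R\<close> votes.\<close>

lemma bucket_candidate:
  assumes g: "\<And>r j. r < 2 * R \<Longrightarrow> fst (g r) j < 32 * k"
    and s: "\<And>r l. r < 2 * R \<Longrightarrow> snd (g r) l \<in> {-1, 1}"
    and i: "i < m" and xi: "4 * h \<le> \<bar>x i\<bar>" and ok: "sketch_ok U g (x(i := 0)) (bucket U i)"
  shows "bucket U i \<in> set (candidates g (run m \<eta> x (sketch U g)))"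
proof -
  let ?j = "bucket U i"
  let ?S = "{r. r < 2 * R \<and> 2 * h \<le> \<bar>\<eta> * real_of_int (run m \<eta> x (sketch U g) ! r ! fst (g r) ?j)\<bar>}"
  let ?E = "{r. r < 2 * R \<and> h \<le> \<bar>sketch_noise U g (x(i := 0)) ?j r\<bar>}"
  have "r \<in> ?S \<union> ?E" if r: "r < 2 * R" for r
  proof (rule ccontr)
    assume "r \<notin> ?S \<union> ?E"
    then have *: "\<bar>\<eta> * \<lfloor>sketch_noise U g x ?j r / \<eta>\<rfloor>\<bar> < 2 * h" "\<bar>sketch_noise U g (x(i := 0)) ?j r\<bar> < h"
      using r by (auto simp: sketch_entry[of r g ?j, OF r g[OF r]])
    have "sketch_noise U g x ?j r = (\<Sum>l<m. (if l = i then x i * snd (g r) i else 0)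
        + (if fst (g r) (bucket U l) = fst (g r) ?j then (x(i := 0)) l else 0) * snd (g r) l)"
      unfolding sketch_noise_def by (intro sum.cong) auto
    then have "sketch_noise U g x ?j r = x i * snd (g r) i + sketch_noise U g (x(i := 0)) ?j r"
      using i by (simp add: sum.distrib sketch_noise_def)
    moreover have "\<bar>x i * snd (g r) i\<bar> = \<bar>x i\<bar>" using s[OF r, of i] by (auto simp: abs_mult)
    ultimately show False
      using * xi floor_eta[of "sketch_noise U g x ?j r"] eta(2) h_pos by linarith
  qed
  then have "{..<2 * R} \<subseteq> ?S \<union> ?E" by blast
  then have "2 * R \<le> card (?S \<union> ?E)"
    using card_mono[of "?S \<union> ?E" "{..<2 * R}"] by simp
  also have "\<dots> \<le> card ?S + card ?E" by (rule card_Un_le)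
  finally have "R < card ?S" using ok by (simp add: sketch_ok_def)
  then show ?thesis
    using P_pos by (simp add: candidates_def bucket_def)
qed

lemma run_alg:
  "run m \<eta> x (alg ((U, s), g)) i = (case map_of (map (\<lambda>j. run m \<eta> x (locate U s j))
      (take (32 * k) (candidates g (run m \<eta> x (sketch U g))))) i of None \<Rightarrow> 0 | Some v \<Rightarrow> \<eta> * real_of_int v)"
  by (simp add: alg_def)

text \<open>Holds for every seed, since \<open>locate\<close> returns an index together with the
  measured value at that index; this keeps the error bounded when the search fails.\<close>

lemma alg_cases:
  assumes "i < m"
  shows "run m \<eta> x (alg w) i = 0 \<or> run m \<eta> x (alg w) i = \<eta> * real_of_int \<lfloor>x i / \<eta>\<rfloor>"
proof -
  obtain U s g where w: "w = ((U, s), g)" by (metis surj_pair)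
  show ?thesis unfolding w run_alg
    using run_locate_value[OF _ assms] by (fastforce split: option.splits dest!: map_of_SomeD)
qed

lemma alg_error_le:
  assumes "i < m" "\<bar>x i\<bar> \<le> 1" "\<eta> \<le> 1"
  shows "\<bar>run m \<eta> x (alg w) i - x i\<bar> \<le> 1"
  using alg_cases[OF assms(1), of x w] floor_eta[of "x i"] assms by auto

lemma alg_correct:
  assumes U: "\<And>l. U l < P T" and s: "\<And>l. s l \<in> {-1, 1}"
    and g: "\<And>r j. r < 2 * R \<Longrightarrow> fst (g r) j < 32 * k"
    and gs: "\<And>r l. r < 2 * R \<Longrightarrow> snd (g r) l \<in> {-1, 1}"
    and w: "(\<Sum>l<m. min 1 ((x l)\<^sup>2 / h\<^sup>2)) \<le> k"
    and loc: "\<And>i. i < m \<Longrightarrow> 4 * h \<le> \<bar>x i\<bar> \<Longrightarrow> locatable U s x i \<and> sketch_ok U g (x(i := 0)) (bucket U i)"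
    and light: "\<And>j. j < P 0 \<Longrightarrow> energy U x j \<le> h\<^sup>2 / 32 \<Longrightarrow> sketch_ok U g x j"
    and i: "i < m"
  shows "\<bar>run m \<eta> x (alg ((U, s), g)) i - x i\<bar> \<le> 4 * h"
proof (cases "4 * h \<le> \<bar>x i\<bar>")
  case False
  then show ?thesis
    using alg_cases[OF i, of x "((U, s), g)"] floor_eta[of "x i"] eta(2) h_pos by auto
next
  case True
  let ?js = "candidates g (run m \<eta> x (sketch U g))"
  let ?G = "{j. j < P 0 \<and> h\<^sup>2 / 32 < (\<Sum>l<m. if bucket U l = j then (x l)\<^sup>2 else 0)}"
  \<comment> \<open>Negligible buckets are excluded by \<open>light\<close>, so there are at most
    \<open>32 * k\<close> candidates and \<open>take\<close> drops none.\<close>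
  have "set ?js \<subseteq> ?G"
    using candidate_imp[OF g] light by (force simp: energy_def not_le)
  then have "card (set ?js) \<le> card ?G"
    by (rule card_mono[rotated]) simp
  moreover have "length ?js = card (set ?js)"
    by (rule distinct_card[symmetric]) (simp add: candidates_def)
  moreover have "real (card ?G) \<le> 32 * k"
    using card_heavy_buckets[OF h_pos, where D = "P 0" and bk = "bucket U" and x = x and m = m] w by linarith
  ultimately have "length ?js \<le> 32 * k" by linarith
  moreover have bucket: "bucket U i \<in> set ?js"
    by (rule bucket_candidate) (use g gs i True loc in auto)
  moreover have locate: "run m \<eta> x (locate U s (bucket U i)) = (i, \<lfloor>x i / \<eta>\<rfloor>)"
    by (rule locate_correct) (use s i True loc U in auto)
  ultimately have "(i, \<lfloor>x i / \<eta>\<rfloor>) \<in> set (map (\<lambda>j. run m \<eta> x (locate U s j)) (take (32 * k) ?js))"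
    using bucket locate by force
  then have "map_of (map (\<lambda>j. run m \<eta> x (locate U s j)) (take (32 * k) ?js)) i \<noteq> None"
    by (metis map_of_eq_None_iff fst_conv image_eqI)
  then obtain v where v: "map_of (map (\<lambda>j. run m \<eta> x (locate U s j)) (take (32 * k) ?js)) i = Some v"
    by blast
  \<comment> \<open>A misled search from another bucket may also return index \<open>i\<close>, even
    earlier in the list, but then with the same measured value.\<close>
  then have "v = \<lfloor>x i / \<eta>\<rfloor>"
    using run_locate_value[OF _ i] by (fastforce dest!: map_of_SomeD)
  then show ?thesis
    unfolding run_alg v using floor_eta[of "x i"] eta(2) h_pos by simp
qed

subsection \<open>Failure probability\<close>

lemma P_0: "P 0 = n ^ 8"
  by (simp add: P_def)

lemma inverse_h: "1 / h\<^sup>2 \<le> n\<^sup>2"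
proof -
  have "1 \<le> h * n" using h n2 by (simp add: field_simps)
  then have "1 \<le> (h * n)\<^sup>2" by (rule one_le_power)
  then show ?thesis using h_pos by (simp add: field_simps power_mult_distrib)
qed

text \<open>By \<open>expo_ge\<close>, \<open>P r\<close> exceeds the squared radix by a factor
  \<open>n ^ (4 + r)\<close>: \<open>n\<^sup>2\<close> pays for \<open>1 / h\<^sup>2\<close>,
  \<open>n\<^sup>2\<close> remains, and \<open>n ^ r\<close> makes the levels summable.\<close>

lemma level_bound: "(real (B r))\<^sup>2 / (P r * h\<^sup>2) \<le> 1 / n\<^sup>2 * (1 / 2) ^ r"
proof -
  have "2 * (expo r div 4) + (4 + r) \<le> expo r"
    using expo_ge[of r] by linarith
  then have "n ^ (2 * (expo r div 4) + (4 + r)) \<le> P r"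
    unfolding P_def using n2 by (intro power_increasing) auto
  then have "(B r)\<^sup>2 * (n ^ 4 * n ^ r) \<le> P r"
    by (simp add: B_def power_add power_mult mult.commute[of 2])
  moreover have "(2::nat) ^ r \<le> n ^ r" using n2 by (intro power_mono) auto
  ultimately have "(B r)\<^sup>2 * (n ^ 4 * 2 ^ r) \<le> P r"
    by (meson le_trans mult_le_mono2)
  then have *: "(real (B r))\<^sup>2 * (n ^ 4 * 2 ^ r) \<le> P r"
    by (metis (mono_tags, lifting) of_nat_le_iff of_nat_mult of_nat_numeral of_nat_power)
  then have "(real (B r))\<^sup>2 / P r \<le> 1 / (n ^ 4 * 2 ^ r)"
    using P_pos[of r] n2 by (simp add: field_simps)
  then have "(real (B r))\<^sup>2 / P r * (1 / h\<^sup>2) \<le> 1 / (n ^ 4 * 2 ^ r) * n\<^sup>2"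
    using inverse_h by (intro mult_mono) auto
  also have "\<dots> = 1 / n\<^sup>2 * (1 / 2) ^ r"
    using n2 by (simp add: field_simps power_numeral_reduce power2_eq_square)
  finally show ?thesis by simp
qed

lemma prob_level:
  assumes i: "i < m" and x: "(\<Sum>l<m. (x l)\<^sup>2) \<le> 1" and r: "r < T"
  shows "measure_pmf.prob (pair_pmf (hash m (P T)) (signs m)) {w. h \<le> \<bar>level_noise (fst w) (snd w) x i r\<bar>}
      \<le> 1 / n\<^sup>2 * (1 / 2) ^ r" (is ?A)
    and "measure_pmf.prob (pair_pmf (hash m (P T)) (signs m)) {w. h \<le> \<bar>digit_noise (fst w) (snd w) x i r\<bar>}
      \<le> 1 / n\<^sup>2 * (1 / 2) ^ r" (is ?B)
proof -
  have dvd: "P r dvd P T" using r by (intro P_dvd) auto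
  have d: "\<bar>real (digit U r l) - real (digit U r i)\<bar> \<le> B r" for U l
    using digit_less[of U r l] digit_less[of U r i] by linarith
  \<comment> \<open>The coefficient \<open>1\<close> is also at most \<open>B r\<close>, so both
    noises obey the same bound.\<close>
  have "measure_pmf.prob (pair_pmf (hash m (P T)) (signs m)) {w. h \<le> \<bar>level_noise (fst w) (snd w) x i r\<bar>}
      \<le> (real (B r))\<^sup>2 / (P r * h\<^sup>2)"
    unfolding level_noise_def
    by (rule prob_locate_noise[OF h_pos i dvd P_pos _ x, of "\<lambda>_ _. 1"]) (use B_pos[of r] in auto)
  then show ?A using level_bound[of r] by linarith
  have "measure_pmf.prob (pair_pmf (hash m (P T)) (signs m)) {w. h \<le> \<bar>digit_noise (fst w) (snd w) x i r\<bar>}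
      \<le> (real (B r))\<^sup>2 / (P r * h\<^sup>2)"
    unfolding digit_noise_def
    by (rule prob_locate_noise[OF h_pos i dvd P_pos _ x, of "\<lambda>U l. real (digit U r l) - real (digit U r i)"])
      (rule d)
  then show ?B using level_bound[of r] by linarith
qed

lemma prob_not_locatable:
  assumes i: "i < m" and x: "(\<Sum>l<m. (x l)\<^sup>2) \<le> 1"
  shows "measure_pmf.prob (pair_pmf (hash m (P T)) (signs m))
     {w. \<not> (locatable (fst w) (snd w) x i \<and> energy (fst w) (x(i := 0)) (bucket (fst w) i) \<le> h\<^sup>2 / 32)}
       \<le> 37 / n\<^sup>2" (is "measure_pmf.prob ?Q ?X \<le> _")
proof -
  let ?L = "\<lambda>r. {w. h \<le> \<bar>level_noise (fst w) (snd w) x i r\<bar>}"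
  let ?D = "\<lambda>r. {w. h \<le> \<bar>digit_noise (fst w) (snd w) x i r\<bar>}"
  let ?I = "{u. \<exists>l<m. l \<noteq> i \<and> u l = u i}"
  let ?E = "{u. h\<^sup>2 / 32 \<le> (\<Sum>l<m. if l \<noteq> i \<and> u l mod P 0 = u i mod P 0 then (x l)\<^sup>2 else 0)}"
  have energy: "energy u (x(i := 0)) (bucket u i) = (\<Sum>l<m. if l \<noteq> i \<and> u l mod P 0 = u i mod P 0 then (x l)\<^sup>2 else 0)" for u
    unfolding energy_def bucket_def by (intro sum.cong) auto
  have "?X \<subseteq> ((\<Union>r<T. ?L r) \<union> (\<Union>r<T. ?D r)) \<union> ({w. fst w \<in> ?I} \<union> {w. fst w \<in> ?E})"
    by (auto simp: locatable_def energy not_le)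
  then have "measure_pmf.prob ?Q ?X \<le> measure_pmf.prob ?Q (((\<Union>r<T. ?L r) \<union> (\<Union>r<T. ?D r)) \<union> ({w. fst w \<in> ?I} \<union> {w. fst w \<in> ?E}))"
    by (intro measure_pmf.finite_measure_mono) auto
  also have "\<dots> \<le> (measure_pmf.prob ?Q (\<Union>r<T. ?L r) + measure_pmf.prob ?Q (\<Union>r<T. ?D r))
       + (measure_pmf.prob ?Q {w. fst w \<in> ?I} + measure_pmf.prob ?Q {w. fst w \<in> ?E})"
    by (rule order.trans[OF measure_Un_le]) (auto intro!: add_mono measure_Un_le)
  \<comment> \<open>Two geometric series over the levels, then duplicate labels by the assumption
    \<open>T\<close>, then the isolation bound, whose \<open>32\<close> comes from the threshold
    \<open>h\<^sup>2 / 32\<close>.\<close>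
  also have "\<dots> \<le> (2 / n\<^sup>2 + 2 / n\<^sup>2) + (1 / n\<^sup>2 + 32 / n\<^sup>2)"
  proof (intro add_mono)
    have geo: "(\<Sum>r<T. 1 / n\<^sup>2 * (1 / 2) ^ r) \<le> 2 / real n ^ 2"
      using mult_left_mono[OF sum_half_powers_le[of T], of "1 / real n ^ 2"] by (simp add: sum_distrib_left)
    have "measure_pmf.prob ?Q (\<Union>r<T. ?L r) \<le> (\<Sum>r<T. measure_pmf.prob ?Q (?L r))"
      by (rule measure_pmf.finite_measure_subadditive_finite) auto
    also have "\<dots> \<le> (\<Sum>r<T. 1 / n\<^sup>2 * (1 / 2) ^ r)" by (intro sum_mono prob_level(1)[OF i x]) auto
    finally show "measure_pmf.prob ?Q (\<Union>r<T. ?L r) \<le> 2 / n\<^sup>2" using geo by simp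
    have "measure_pmf.prob ?Q (\<Union>r<T. ?D r) \<le> (\<Sum>r<T. measure_pmf.prob ?Q (?D r))"
      by (rule measure_pmf.finite_measure_subadditive_finite) auto
    also have "\<dots> \<le> (\<Sum>r<T. 1 / n\<^sup>2 * (1 / 2) ^ r)" by (intro sum_mono prob_level(2)[OF i x]) auto
    finally show "measure_pmf.prob ?Q (\<Union>r<T. ?D r) \<le> 2 / n\<^sup>2" using geo by simp
    have "measure_pmf.prob ?Q {w. fst w \<in> ?I} \<le> m / P T"
      unfolding prob_pair_pmf_fst by (rule prob_not_injective[OF i P_pos])
    also have "\<dots> \<le> 1 / n\<^sup>2"
    proof -
      have "real (m * n\<^sup>2) \<le> real (P T)" using T by (simp only: P_def of_nat_le_iff)
      then show ?thesis using n2 P_pos[of T] by (simp add: field_simps)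
    qed
    finally show "measure_pmf.prob ?Q {w. fst w \<in> ?I} \<le> 1 / n\<^sup>2" .
    have "measure_pmf.prob ?Q {w. fst w \<in> ?E} \<le> 1 / (P 0 * (h\<^sup>2 / 32))"
      unfolding prob_pair_pmf_fst
      by (rule prob_not_isolated[OF _ i P_dvd P_pos x]) (use h_pos in auto)
    also have "\<dots> = 32 / P 0 * (1 / h\<^sup>2)" by simp
    also have "\<dots> \<le> 32 / P 0 * n\<^sup>2" by (intro mult_left_mono inverse_h) auto
    also have "\<dots> = 32 / n ^ 6"
      using n2 by (simp add: P_0 power2_eq_square power_numeral_reduce)
    also have "\<dots> \<le> 32 / n\<^sup>2"
      using n2 by (intro divide_left_mono power_increasing) auto
    finally show "measure_pmf.prob ?Q {w. fst w \<in> ?E} \<le> 32 / n\<^sup>2" by simp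
  qed
  also have "\<dots> = 37 / n\<^sup>2" by simp
  finally show ?thesis .
qed

definition sketch_pmf :: "sketch_seed pmf" where
  "sketch_pmf = Pi_pmf {..<2 * R} undefined (\<lambda>_. pair_pmf (hash (P 0) (32 * k)) (signs m))"

text \<open>The sketch is independent of the labels, so its failure can be estimated for fixed
  buckets.\<close>

definition seeds :: "(((nat \<Rightarrow> nat) \<times> (nat \<Rightarrow> real)) \<times> sketch_seed) pmf" where
  "seeds = pair_pmf (pair_pmf (hash m (P T)) (signs m)) sketch_pmf"

lemma finite_sketch_pmf: "finite (set_pmf sketch_pmf)"
  unfolding sketch_pmf_def by (rule finite_set_Pi_pmf) (use k1 in auto)

lemma finite_seeds: "finite (set_pmf seeds)"
  using finite_sketch_pmf P_pos by (simp add: seeds_def)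

lemma set_sketch_pmf:
  assumes "g \<in> set_pmf sketch_pmf" "r < 2 * R"
  shows "fst (g r) j < 32 * k" "snd (g r) l \<in> {-1, 1}"
proof -
  have "g r \<in> set_pmf (pair_pmf (hash (P 0) (32 * k)) (signs m))"
    using assms by (auto simp: sketch_pmf_def set_Pi_pmf PiE_dflt_def)
  then have "fst (g r) \<in> set_pmf (hash (P 0) (32 * k))" "snd (g r) \<in> set_pmf (signs m)"
    by auto
  then show "fst (g r) j < 32 * k" "snd (g r) l \<in> {-1, 1}"
    using set_hash[of "32 * k" "fst (g r)" "P 0" j] set_signs[of "snd (g r)" m l] k1 by auto
qed

lemma prob_not_sketch_ok:
  assumes j: "j < P 0" and e: "energy U z j \<le> h\<^sup>2 / 32"
    and w: "(\<Sum>l<m. min 1 ((z l)\<^sup>2 / h\<^sup>2)) \<le> k"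
  shows "measure_pmf.prob sketch_pmf {g. \<not> sketch_ok U g z j} \<le> 1 / real n ^ 9"
proof -
  let ?X = "{w. h \<le> \<bar>\<Sum>l<m. (if fst w (bucket U l) = fst w j then z l else 0) * snd w l\<bar>}"
  have "measure_pmf.prob sketch_pmf {g. R \<le> card {r. r < 2 * R \<and> g r \<in> ?X}} \<le> (1 / 4) ^ R"
    unfolding sketch_pmf_def
    by (intro prob_majority prob_sketch_noise)
       (use h_pos k1 j e w P_pos in \<open>auto simp: bucket_def energy_def\<close>)
  also have "{g. R \<le> card {r. r < 2 * R \<and> g r \<in> ?X}} = {g. \<not> sketch_ok U g z j}"
    by (simp add: sketch_ok_def sketch_noise_def)
  also have "(1 / 4) ^ R \<le> 1 / real n ^ 9"
  proof -
    have "real (n ^ 9) \<le> real (4 ^ R)" using R by (simp only: of_nat_le_iff)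
    then show ?thesis using n2 by (simp add: power_divide frac_le)
  qed
  finally show ?thesis .
qed

lemma card_heavy:
  assumes w: "(\<Sum>l<m. min 1 ((x l)\<^sup>2 / h\<^sup>2)) \<le> k"
  shows "real (card {i. i < m \<and> 4 * h \<le> \<bar>x i\<bar>}) \<le> k"
proof -
  let ?H = "{i. i < m \<and> 4 * h \<le> \<bar>x i\<bar>}"
  have one: "1 \<le> min 1 ((x i)\<^sup>2 / h\<^sup>2)" if "i \<in> ?H" for i
  proof -
    have "\<bar>h\<bar> \<le> \<bar>x i\<bar>" using that h_pos by auto
    then have "h\<^sup>2 \<le> (x i)\<^sup>2" by (simp only: abs_le_square_iff)
    then show ?thesis using h_pos by simp
  qed
  have "real (card ?H) = (\<Sum>i\<in>?H. 1)" by simp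
  also have "\<dots> \<le> (\<Sum>i\<in>?H. min 1 ((x i)\<^sup>2 / h\<^sup>2))" by (intro sum_mono one)
  also have "\<dots> \<le> (\<Sum>l<m. min 1 ((x l)\<^sup>2 / h\<^sup>2))" by (rule sum_mono2) auto
  finally show ?thesis using w by simp
qed

lemma prob_alg_error:
  assumes x: "(\<Sum>l<m. (x l)\<^sup>2) \<le> 1" and w: "(\<Sum>l<m. min 1 ((x l)\<^sup>2 / h\<^sup>2)) \<le> k"
  shows "measure_pmf.prob seeds {w. \<exists>i<m. 4 * h < \<bar>run m \<eta> x (alg w) i - x i\<bar>} \<le> 39 / n"
    (is "measure_pmf.prob _ ?bad \<le> _")
proof -
  let ?H = "{i. i < m \<and> 4 * h \<le> \<bar>x i\<bar>}"
  let ?W = "\<lambda>i. {w. \<not> (locatable (fst w) (snd w) x i \<and> energy (fst w) (x(i := 0)) (bucket (fst w) i) \<le> h\<^sup>2 / 32)}"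
  let ?J = "\<lambda>U. {j. j < P 0 \<and> energy U x j \<le> h\<^sup>2 / 32}"
  \<comment> \<open>Only large coordinates in an otherwise light bucket must pass the sketch; the
    others fall under \<open>?B1\<close>, since \<open>?W\<close> includes the energy
    condition.\<close>
  let ?HU = "\<lambda>U. {i \<in> ?H. energy U (x(i := 0)) (bucket U i) \<le> h\<^sup>2 / 32}"
  let ?S = "\<lambda>U. (\<Union>j\<in>?J U. {g. \<not> sketch_ok U g x j}) \<union> (\<Union>i\<in>?HU U. {g. \<not> sketch_ok U g (x(i := 0)) (bucket U i)})"
  let ?B1 = "{w. fst w \<in> (\<Union>i\<in>?H. ?W i)}"
  let ?B2 = "{w. snd w \<in> ?S (fst (fst w))}"
  have "w \<in> ?B1 \<union> ?B2" if "w \<in> set_pmf seeds" "w \<in> ?bad" for w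
  proof (rule ccontr)
    assume not: "w \<notin> ?B1 \<union> ?B2"
    obtain U s g where wd: "w = ((U, s), g)" by (metis surj_pair)
    have U: "U l < P T" and s: "s l \<in> {-1, 1}" and g: "g \<in> set_pmf sketch_pmf" for l
      using that(1) set_hash[OF P_pos] set_signs[of s m l] by (auto simp: seeds_def wd)
    from that(2) obtain i where i: "i < m" "4 * h < \<bar>run m \<eta> x (alg w) i - x i\<bar>" by blast
    have "\<bar>run m \<eta> x (alg ((U, s), g)) i - x i\<bar> \<le> 4 * h"
    proof (rule alg_correct[OF U s set_sketch_pmf(1)[OF g] set_sketch_pmf(2)[OF g] w _ _ i(1)])
      fix i assume "i < m" "4 * h \<le> \<bar>x i\<bar>"
      then show "locatable U s x i \<and> sketch_ok U g (x(i := 0)) (bucket U i)"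
        using not by (auto simp: wd)
    next
      fix j assume "j < P 0" "energy U x j \<le> h\<^sup>2 / 32"
      then show "sketch_ok U g x j" using not by (auto simp: wd)
    qed
    with i wd show False by simp
  qed
  \<comment> \<open>The inclusion is available on the support, where labels, cells and signs lie in
    their ranges.\<close>
  then have "measure_pmf.prob seeds ?bad \<le> measure_pmf.prob seeds (?B1 \<union> ?B2)"
    by (intro measure_pmf.finite_measure_mono_AE) (auto simp: AE_measure_pmf_iff)
  also have "\<dots> \<le> measure_pmf.prob seeds ?B1 + measure_pmf.prob seeds ?B2"
    by (rule measure_Un_le) auto
  also have "\<dots> \<le> 37 / n + 2 / n"
  proof (rule add_mono)
    have "measure_pmf.prob seeds ?B1 = measure_pmf.prob (pair_pmf (hash m (P T)) (signs m)) (\<Union>i\<in>?H. ?W i)"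
      unfolding seeds_def by (rule prob_pair_pmf_fst)
    also have "\<dots> \<le> (\<Sum>i\<in>?H. measure_pmf.prob (pair_pmf (hash m (P T)) (signs m)) (?W i))"
      by (rule measure_pmf.finite_measure_subadditive_finite) auto
    also have "\<dots> \<le> (\<Sum>i\<in>?H. 37 / n\<^sup>2)"
      by (intro sum_mono prob_not_locatable[OF _ x]) auto
    also have "\<dots> = card ?H * (37 / n\<^sup>2)" by simp
    \<comment> \<open>The union over at most \<open>k \<le> n\<close> large coordinates uses up one
      factor \<open>1 / n\<close>.\<close>
    also have "\<dots> \<le> n * (37 / n\<^sup>2)"
      using card_heavy[OF w] kn by (intro mult_right_mono) auto
    also have "\<dots> = 37 / n" using n2 by (simp add: power2_eq_square)
    finally show "measure_pmf.prob seeds ?B1 \<le> 37 / n" .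
  next
    show "measure_pmf.prob seeds ?B2 \<le> 2 / n"
      unfolding seeds_def
    proof (rule prob_pair_pmf_le)
      fix a :: "(nat \<Rightarrow> nat) \<times> (nat \<Rightarrow> real)"
      let ?U = "fst a"
      have wi: "(\<Sum>l<m. min 1 (((x(i := 0)) l)\<^sup>2 / h\<^sup>2)) \<le> k" for i
        by (rule order.trans[OF sum_mono w]) auto
      have finJ: "finite (?J ?U)" and finH: "finite (?HU ?U)" by auto
      have "measure_pmf.prob sketch_pmf (?S ?U)
          \<le> measure_pmf.prob sketch_pmf (\<Union>j\<in>?J ?U. {g. \<not> sketch_ok ?U g x j})
            + measure_pmf.prob sketch_pmf (\<Union>i\<in>?HU ?U. {g. \<not> sketch_ok ?U g (x(i := 0)) (bucket ?U i)})"
        by (rule measure_Un_le) auto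
      also have "\<dots> \<le> (\<Sum>j\<in>?J ?U. measure_pmf.prob sketch_pmf {g. \<not> sketch_ok ?U g x j})
            + (\<Sum>i\<in>?HU ?U. measure_pmf.prob sketch_pmf {g. \<not> sketch_ok ?U g (x(i := 0)) (bucket ?U i)})"
        by (intro add_mono measure_pmf.finite_measure_subadditive_finite finJ finH) auto
      also have "\<dots> \<le> (\<Sum>j\<in>?J ?U. 1 / real n ^ 9) + (\<Sum>i\<in>?HU ?U. 1 / real n ^ 9)"
        using P_pos by (intro add_mono sum_mono prob_not_sketch_ok w wi) (auto simp: bucket_def)
      also have "\<dots> = (real (card (?J ?U)) + real (card (?HU ?U))) * (1 / real n ^ 9)"
        by (simp add: add_divide_distrib)
      \<comment> \<open>There are \<open>n ^ 8\<close> buckets and at most \<open>n\<close> large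
        coordinates; failure probability \<open>1 / n ^ 9\<close> for each leaves
        \<open>2 / n\<close> in total.\<close>
      also have "\<dots> \<le> (real n ^ 8 + real n ^ 8) * (1 / real n ^ 9)"
      proof (intro mult_right_mono add_mono)
        have "card (?J ?U) \<le> card {..<P 0}" by (rule card_mono) auto
        then show "real (card (?J ?U)) \<le> real n ^ 8" by (simp add: P_0 flip: of_nat_power)
        have "card (?HU ?U) \<le> card ?H" by (rule card_mono) auto
        also have "\<dots> \<le> n" using card_heavy[OF w] kn by simp
        also have "n \<le> n ^ 8" using n2 by (intro self_le_power) auto
        finally show "real (card (?HU ?U)) \<le> real n ^ 8" by (simp flip: of_nat_power)
      qed simp
      also have "\<dots> = 2 / n" using n2 by (simp add: power_numeral_reduce field_simps)
      finally have "measure_pmf.prob sketch_pmf (?S ?U) \<le> 2 / n" .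
      moreover have "{b. (a, b) \<in> ?B2} = ?S ?U"
        by (simp only: mem_Collect_eq fst_conv snd_conv Collect_mem_eq)
      ultimately show "measure_pmf.prob sketch_pmf {b. (a, b) \<in> ?B2} \<le> 2 / n"
        by (simp only:)
    qed (use P_pos finite_sketch_pmf in auto)
  qed
  also have "\<dots> = 39 / n" by (simp add: add_divide_distrib[symmetric])
  finally show ?thesis .
qed

text \<open>The error is at most \<open>4 * h\<close> off the bad event and at most \<open>1\<close>
  on it, and \<open>39 / n \<le> 39 * h\<close>.\<close>

lemma expected_error:
  assumes m: "m > 0" and x: "(\<Sum>l<m. (x l)\<^sup>2) \<le> 1" and w: "(\<Sum>l<m. min 1 ((x l)\<^sup>2 / h\<^sup>2)) \<le> k"
    and x1: "\<And>i. i < m \<Longrightarrow> \<bar>x i\<bar> \<le> 1" and h1: "h \<le> 1"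
  shows "(\<integral>\<^sup>+w. ennreal (linf_norm m (\<lambda>i. run m \<eta> x (alg w) i - x i)) \<partial>seeds) \<le> ennreal (43 * h)"
proof -
  let ?bad = "{w. \<exists>i<m. 4 * h < \<bar>run m \<eta> x (alg w) i - x i\<bar>}"
  have linf: "linf_norm m u \<le> c" if "\<And>i. i < m \<Longrightarrow> \<bar>u i\<bar> \<le> c" for u c
    unfolding linf_norm_def using that m by (subst Max_le_iff) auto
  have "ennreal (linf_norm m (\<lambda>i. run m \<eta> x (alg w) i - x i)) \<le> ennreal (4 * h) + indicator ?bad w" for w
  proof (cases "w \<in> ?bad")
    case True
    have "linf_norm m (\<lambda>i. run m \<eta> x (alg w) i - x i) \<le> 1"
      using alg_error_le x1 eta(2) h1 h_pos by (intro linf) auto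
    then have "ennreal (linf_norm m (\<lambda>i. run m \<eta> x (alg w) i - x i)) \<le> 1"
      by (simp add: ennreal_le_1)
    then show ?thesis using True by (simp add: add_increasing)
  next
    case False
    then have "linf_norm m (\<lambda>i. run m \<eta> x (alg w) i - x i) \<le> 4 * h"
      by (intro linf) (force simp: not_less)
    then show ?thesis using False by (simp add: ennreal_leI)
  qed
  then have "(\<integral>\<^sup>+w. ennreal (linf_norm m (\<lambda>i. run m \<eta> x (alg w) i - x i)) \<partial>seeds)
     \<le> (\<integral>\<^sup>+w. ennreal (4 * h) + indicator ?bad w \<partial>seeds)"
    by (intro nn_integral_mono) auto
  also have "\<dots> = ennreal (4 * h) + ennreal (measure_pmf.prob seeds ?bad)"
    by (subst nn_integral_add) (auto simp: measure_pmf.emeasure_eq_measure)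
  also have "\<dots> \<le> ennreal (4 * h) + ennreal (39 * h)"
  proof (intro add_left_mono ennreal_leI)
    have "39 / n \<le> 39 * h" using h by simp
    with prob_alg_error[OF x w] show "measure_pmf.prob seeds ?bad \<le> 39 * h" by linarith
  qed
  also have "\<dots> = ennreal (43 * h)" using h_pos by (simp flip: ennreal_plus)
  finally show ?thesis .
qed

end

section \<open>Choice of the parameters\<close>

text \<open>The exponent grows like \<open>(8 / 7) ^ T\<close>, so it reaches the order of
  \<open>ln m\<close> after \<open>O(ln (ln m))\<close> levels.\<close>

lemma hash_range_large:
  assumes n: "2 \<le> n" and m: "3 \<le> m" and T: "8 * ln (ln (real m)) \<le> T"
  shows "m * n\<^sup>2 \<le> n ^ expo T"
proof -
  have lnm: "0 < ln (real m)" using m by simp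
  \<comment> \<open>Equivalent to \<open>exp (1 / 8) \<le> 8 / 7\<close>, where
    \<open>exp_bound\<close> gives \<open>1 + 1 / 8 + 1 / 64\<close>.\<close>
  have "1 / 8 \<le> ln (8 / 7 :: real)"
    using ln_ge_iff[of "8/7" "1/8"] exp_bound[of "1/8 :: real"] by (simp add: power2_eq_square)
  then have "T * (1 / 8) \<le> T * ln (8 / 7 :: real)" by (intro mult_left_mono) auto
  with T have "ln (ln (real m)) \<le> T * ln (8 / 7 :: real)" by simp
  also have "\<dots> = ln ((8 / 7) ^ T)" by (simp add: ln_realpow)
  finally have "ln (real m) \<le> (8 / 7) ^ T" using lnm by simp
  moreover have "8 \<le> expo T" using expo_ge[of T] by linarith
  \<comment> \<open>Two factors \<open>n\<close> are set aside for \<open>n\<^sup>2\<close>; since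
    \<open>expo T \<ge> 8\<close>, at least half of the exponent remains.\<close>
  ultimately have "4 * ln (real m) \<le> real (expo T - 2)"
    using expo_growth[of T] by (simp add: of_nat_diff)
  moreover have "1 / 2 \<le> ln (2 :: real)" using ln2_ge_two_thirds by simp
  ultimately have "ln (real m) \<le> (expo T - 2) * ln 2"
    using mult_left_mono[of "1/2" "ln 2" "real (expo T - 2)"] lnm by linarith
  then have "ln (real m) \<le> ln (2 ^ (expo T - 2))" by (simp add: ln_realpow)
  then have "real m \<le> 2 ^ (expo T - 2)" using m by simp
  then have "m \<le> 2 ^ (expo T - 2)" by (simp flip: of_nat_le_iff)
  also have "\<dots> \<le> n ^ (expo T - 2)" using n by (intro power_mono) auto
  finally have "m * n\<^sup>2 \<le> n ^ (expo T - 2) * n\<^sup>2" by simp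
  also have "\<dots> = n ^ (expo T - 2 + 2)" by (simp only: power_add)
  also have "expo T - 2 + 2 = expo T" using \<open>8 \<le> expo T\<close> by simp
  finally show ?thesis .
qed

lemma repetitions_suffice:
  assumes "2 \<le> n" "9 * ln (real n) \<le> R"
  shows "n ^ 9 \<le> 4 ^ R"
proof -
  have "ln (real n ^ 9) = 9 * ln (real n)" using assms by (simp add: ln_realpow)
  also have "\<dots> \<le> R * ln 4"
    using assms ln2_ge_two_thirds ln_mono[of "exp 1" 4] exp_le mult_left_mono[of 1 "ln 4" "real R"] by simp
  also have "\<dots> = ln (4 ^ R)" by (simp add: ln_realpow)
  finally have "real n ^ 9 \<le> 4 ^ R" using assms by simp
  then show ?thesis using of_nat_le_iff[where 'a = real, of "n ^ 9" "4 ^ R"] by simp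
qed

lemma lp_ball_facts:
  assumes p: "1 \<le> p" "p \<le> 2" and x: "lp_norm p m x \<le> 1"
  shows "\<And>i. i < m \<Longrightarrow> \<bar>x i\<bar> \<le> 1"
    and "(\<Sum>l<m. (x l)\<^sup>2) \<le> 1"
    and "h > 0 \<Longrightarrow> (\<Sum>l<m. min 1 ((x l)\<^sup>2 / h\<^sup>2)) \<le> h powr - p"
proof -
  have sum0: "0 \<le> (\<Sum>i<m. \<bar>x i\<bar> powr p)" by (intro sum_nonneg) auto
  have "lp_norm p m x powr p \<le> 1 powr p"
    using p x by (intro powr_mono2) (auto simp: lp_norm_def)
  then have sum1: "(\<Sum>i<m. \<bar>x i\<bar> powr p) \<le> 1"
    using p sum0 by (simp add: lp_norm_def powr_powr)
  show x1: "\<bar>x i\<bar> \<le> 1" if "i < m" for i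
    using abs_le_lp_norm[of p i m x] p x that by simp
  \<comment> \<open>Applied to \<open>x l / h\<close>, this bounds the capped weights by p-th
    powers; \<open>p \<le> 2\<close> enters for \<open>\<bar>t\<bar> \<le> 1\<close>.\<close>
  have main: "min 1 (t\<^sup>2) \<le> \<bar>t\<bar> powr p" for t :: real
  proof (cases "\<bar>t\<bar> \<le> 1")
    case True
    have "t\<^sup>2 = \<bar>t\<bar> powr 2" by simp
    also have "\<dots> \<le> \<bar>t\<bar> powr p" using True p by (intro powr_mono') auto
    finally show ?thesis by simp
  next
    case False
    then have "1 \<le> \<bar>t\<bar> powr p" using p by (intro ge_one_powr_ge_zero) auto
    then show ?thesis by simp
  qed
  show "(\<Sum>l<m. min 1 ((x l)\<^sup>2 / h\<^sup>2)) \<le> h powr - p" if h: "h > 0" for h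
  proof -
    have "(\<Sum>l<m. min 1 ((x l)\<^sup>2 / h\<^sup>2)) \<le> (\<Sum>l<m. \<bar>x l\<bar> powr p * h powr - p)"
    proof (rule sum_mono)
      fix l
      show "min 1 ((x l)\<^sup>2 / h\<^sup>2) \<le> \<bar>x l\<bar> powr p * h powr - p"
        using main[of "x l / h"] h by (simp add: power_divide powr_divide powr_minus_divide)
    qed
    also have "\<dots> = (\<Sum>l<m. \<bar>x l\<bar> powr p) * h powr - p" by (simp add: sum_distrib_right)
    also have "\<dots> \<le> 1 * h powr - p" by (intro mult_right_mono sum1) auto
    finally show ?thesis by simp
  qed
  have "(\<Sum>l<m. (x l)\<^sup>2) = (\<Sum>l<m. min 1 ((x l)\<^sup>2))"
    using x1 by (intro sum.cong) (auto simp: abs_square_le_1)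
  also have "\<dots> \<le> (\<Sum>l<m. \<bar>x l\<bar> powr p)" by (intro sum_mono main)
  finally show "(\<Sum>l<m. (x l)\<^sup>2) \<le> 1" using sum1 by simp
qed

text \<open>The algorithm that measures nothing and returns \<open>0\<close> achieves this.\<close>

lemma e_ran_le_one:
  assumes p: "p > 0" and m: "m > 0"
  shows "e_ran n m (lp_norm p m) m (linf_norm m) (\<lambda>x. x) \<le> 1"
proof (rule e_ran_le[OF p, of "return_pmf ()" n "\<lambda>_. Return (\<lambda>_. 0)" m 1])
  fix x assume x: "lp_norm p m x \<le> 1"
  have "linf_norm m (\<lambda>i. 0 - x i) \<le> 1"
    unfolding linf_norm_def using m
    by (subst Max_le_iff) (auto intro: order.trans[OF abs_le_lp_norm[OF p] x])
  then show "(\<integral>\<^sup>+ w. ennreal (linf_norm m (\<lambda>i. run m 1 x (Return (\<lambda>_. 0)) i - x i)) \<partial>return_pmf ()) \<le> 1"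
    by simp
qed (auto intro: cost_le.Return)

text \<open>The choice of \<open>h\<close> makes \<open>h powr - p = k\<close>, so the capped weight
  of a vector in the unit ball is at most \<open>k\<close>.\<close>

lemma e_ran_le_sparse:
  assumes p: "1 \<le> p" "p \<le> 2" and n: "2 \<le> n" and m: "3 \<le> m"
    and k: "1 \<le> k" "832 * k * (ln (real n) + ln (ln (real m))) \<le> n"
  shows "e_ran n m (lp_norm p m) m (linf_norm m) (\<lambda>x. x) \<le> ennreal (43 * real k powr - (1 / p))"
proof -
  define R where "R = nat \<lceil>9 * ln (real n)\<rceil>"
  define T where "T = nat \<lceil>8 * ln (ln (real m))\<rceil>"
  define h where "h = real k powr - (1 / p)"
  \<comment> \<open>Fine enough for all levels at once, since
    \<open>expo r div 4 \<le> expo T\<close> for \<open>r < T\<close>.\<close>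
  define \<eta> where "\<eta> = h / (4 * (1 + real n ^ expo T))"
  have "exp 1 < real m" using exp_le m e_less_272 by linarith
  then have "ln (exp 1) < ln (real m)" using m by (subst ln_less_cancel_iff) auto
  then have "1 < ln (real m)" by simp
  then have lln: "0 < ln (ln (real m))" by simp
  have "ln 2 \<le> ln (real n)" using n by simp
  then have lnn: "2 / 3 \<le> ln (real n)" using ln2_ge_two_thirds by linarith
  have R: "9 * ln (real n) \<le> R" "R \<le> 9 * ln (real n) + 1"
    using lnn unfolding R_def by linarith+
  have T: "8 * ln (ln (real m)) \<le> T" "T \<le> 8 * ln (ln (real m)) + 1"
    using lln unfolding T_def by linarith+
  \<comment> \<open>The left side is at most \<open>18 * ln n + 16 * ln (ln m) + 5\<close>, and
    \<open>5 \<le> 8 * ln n\<close>. The cost is \<open>32 * k\<close> times it, and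
    \<open>32 * 26 = 832\<close>.\<close>
  have "real (2 * R + 2 * T + 1) \<le> 26 * (ln (real n) + ln (ln (real m)))"
    using R T lnn lln by simp
  then have "32 * k * real (2 * R + 2 * T + 1) \<le> 32 * k * (26 * (ln (real n) + ln (ln (real m))))"
    by (intro mult_left_mono) auto
  also have "\<dots> = 832 * real k * (ln (real n) + ln (ln (real m)))" by simp
  also have "\<dots> \<le> n" using k(2) by simp
  finally have "real (32 * k * (2 * R + 2 * T + 1)) \<le> real n" by (simp add: algebra_simps)
  then have "32 * k * (2 * R + 2 * T + 1) \<le> n" by (simp only: of_nat_le_iff)
  then have cost: "2 * R * (32 * k) + 32 * k * (2 * T + 1) \<le> n" by (simp add: algebra_simps)
  then have kn: "k \<le> n" by (simp add: algebra_simps)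
  have kp: "real k powr (1 / p) \<le> real k powr 1" using k p by (intro powr_mono) auto
  have h0: "h > 0" using k by (simp add: h_def)
  have h1: "h \<le> 1" using k p powr_mono[of "- (1 / p)" 0 "real k"] by (simp add: h_def)
  have "1 / n \<le> 1 / k" using k kn by (intro divide_left_mono) auto
  also have "\<dots> \<le> 1 / real k powr (1 / p)" using kp k by (intro divide_left_mono) auto
  finally have hn: "1 / n \<le> h" by (simp add: h_def powr_minus divide_inverse)
  have "0 < h / (4 * (1 + t))" "h / (4 * (1 + t)) \<le> h / 4" if "0 \<le> t" for t
    using h0 that by (auto simp: field_simps)
  from this[of "real n ^ expo T"] have eta0: "0 < \<eta>" "\<eta> \<le> h / 4"
    by (simp_all add: \<eta>_def)
  have eta: "\<eta> * (1 + n ^ (expo r div 4)) \<le> h / 4" if "r < T" for r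
  proof -
    have "expo r div 4 \<le> expo T" using expo_mono[of r T] that by linarith
    then have "real n ^ (expo r div 4) \<le> real n ^ expo T" using n by (intro power_increasing) auto
    then have "\<eta> * (1 + n ^ (expo r div 4)) \<le> \<eta> * (1 + n ^ expo T)"
      using eta0 by (intro mult_left_mono) auto
    also have "\<dots> = h / 4" by (simp add: \<eta>_def field_simps add_nonneg_eq_0_iff)
    finally show ?thesis .
  qed
  interpret recovery m n k R T h \<eta>
    by unfold_locales
       (use n k kn hn eta0 eta in \<open>auto intro: repetitions_suffice[OF n R(1)] hash_range_large[OF n m T(1)]\<close>)
  have hp: "h powr - p = k" using k p by (simp add: h_def powr_powr)
  show ?thesis
  proof (rule e_ran_le[OF _ finite_seeds, of p n alg m \<eta>])
    show "cost_le n (alg w)" for w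
      by (rule cost_le_mono[OF cost_alg cost])
    fix x assume x: "lp_norm p m x \<le> 1"
    note facts = lp_ball_facts[OF p x]
    show "(\<integral>\<^sup>+w. ennreal (linf_norm m (\<lambda>i. run m \<eta> x (alg w) i - x i)) \<partial>seeds)
        \<le> ennreal (43 * real k powr - (1 / p))"
      unfolding h_def[symmetric]
      by (rule expected_error[OF _ facts(2) _ facts(1) h1])
         (use m facts(3)[OF h0] hp in auto)
  qed (use p in auto)
qed

theorem theorem3p3:
  fixes p :: real
  assumes "1 \<le> p" and "p \<le> 2"
  shows "\<exists>C>0. \<exists>m0 n0 :: nat. \<forall>m n :: nat. m \<ge> m0 \<longrightarrow> n \<ge> n0 \<longrightarrow>
    e_ran n m (lp_norm p m) m (linf_norm m) (\<lambda>x. x)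
      \<le> ennreal (C * min 1 (((ln (real n) + ln (ln (real m))) / real n) powr (1 / p)))"
proof (intro exI[of _ "43 * 1664 :: real"] exI[of _ "3 :: nat"] conjI allI impI)
  fix m n :: nat
  assume m: "3 \<le> m" and "3 \<le> n"
  then have n: "2 \<le> n" by simp
  define \<mu> where "\<mu> = ln (real n) + ln (ln (real m))"
  let ?e = "e_ran n m (lp_norm p m) m (linf_norm m) (\<lambda>x. x)"
  have "exp 1 < real m" using m e_less_272 by linarith
  then have "ln (exp 1) < ln (real m)" using m by (subst ln_less_cancel_iff) auto
  then have "1 < ln (real m)" by simp
  then have \<mu>: "\<mu> > 0" using n by (simp add: \<mu>_def add_pos_pos)
  \<comment> \<open>As \<open>1 / p \<le> 1\<close>, constants \<open>c \<ge> 1\<close> leave the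
    power as at most \<open>c\<close>, uniformly in \<open>p\<close>.\<close>
  have shrink: "c powr (1 / p) \<le> c" if "1 \<le> c" for c :: real
    using powr_mono[of "1 / p" 1 c] that assms by simp
  show "?e \<le> ennreal (43 * 1664 * min 1 (((ln (real n) + ln (ln (real m))) / real n) powr (1 / p)))"
    unfolding \<mu>_def[symmetric]
  proof (cases "832 * \<mu> \<le> n")
    case False
    \<comment> \<open>Here the minimum is at least \<open>1 / 832\<close>, so the claimed bound
      exceeds \<open>1\<close> and the zero algorithm suffices.\<close>
    have "1 / 832 \<le> (1 / 832 :: real) powr (1 / p)"
      using powr_mono'[of "1 / p" 1 "1 / 832"] assms by simp
    also have "\<dots> \<le> (\<mu> / n) powr (1 / p)"
      using False n assms by (intro powr_mono2) (auto simp: field_simps)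
    finally have "1 \<le> 43 * 1664 * min 1 ((\<mu> / n) powr (1 / p))" by simp
    then have "1 \<le> ennreal (43 * 1664 * min 1 ((\<mu> / n) powr (1 / p)))" by simp
    moreover have "?e \<le> 1" by (rule e_ran_le_one) (use assms m in auto)
    ultimately show "?e \<le> ennreal (43 * 1664 * min 1 ((\<mu> / n) powr (1 / p)))" by (rule order.trans[rotated])
  next
    case True
    define k where "k = nat \<lfloor>n / (832 * \<mu>)\<rfloor>"
    have "1 \<le> n / (832 * \<mu>)" using True \<mu> by simp
    then have "1 \<le> \<lfloor>n / (832 * \<mu>)\<rfloor>" by simp
    moreover from this have "real k = \<lfloor>n / (832 * \<mu>)\<rfloor>" by (simp add: k_def)
    \<comment> \<open>Rounding down a number that is at least \<open>1\<close> loses at most a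
      factor \<open>2\<close>, whence \<open>1664 = 2 * 832\<close>.\<close>
    ultimately have k: "1 \<le> k" "k \<le> n / (832 * \<mu>)" "n / (832 * \<mu>) \<le> 2 * real k"
      by linarith+
    have "832 * real k * \<mu> \<le> n" using k(2) \<mu> by (simp add: field_simps)
    then have "?e \<le> ennreal (43 * real k powr - (1 / p))"
      unfolding \<mu>_def by (rule e_ran_le_sparse[OF assms n m k(1)])
    also have "\<dots> \<le> ennreal (43 * 1664 * min 1 ((\<mu> / n) powr (1 / p)))"
    proof (rule ennreal_leI)
      have "1 / k \<le> 1664 * (\<mu> / n)" using k \<mu> n by (simp add: field_simps)
      then have "(1 / k) powr (1 / p) \<le> (1664 * (\<mu> / n)) powr (1 / p)"
        using assms by (intro powr_mono2) auto
      also have "\<dots> = 1664 powr (1 / p) * (\<mu> / n) powr (1 / p)"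
        using \<mu> by (intro powr_mult)
      also have "\<dots> \<le> 1664 * (\<mu> / n) powr (1 / p)"
        by (intro mult_right_mono shrink) auto
      finally have "real k powr - (1 / p) \<le> 1664 * (\<mu> / n) powr (1 / p)"
        by (simp add: powr_minus_divide powr_divide)
      moreover have "(\<mu> / n) powr (1 / p) \<le> 1"
        using True \<mu> n assms by (intro powr_le1) auto
      ultimately show "43 * real k powr - (1 / p) \<le> 43 * 1664 * min 1 ((\<mu> / n) powr (1 / p))"
        by simp
    qed
    finally show "?e \<le> ennreal (43 * 1664 * min 1 ((\<mu> / n) powr (1 / p)))" .
  qed
qed simp

end
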